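(* Let $d\in\{2,3\}$ and let $B$ be a two-parameter Brownian sheet in $\mathbf{R}^d$. Then outside a single $\mathrm{P}$-null set, \[ \dim_{\mathrm H}\Big(B^{-1}\{0\}\cap\big(\{s\}\times(0,\infty)\big)\Big)=0\qquad\text{for all }s>0 . \]
   Context: A two-parameter Brownian sheet in $\mathbf{R}^d$ is a continuous centered Gaussian process $\{B(s,t)\}_{s,t\ge0}$ with values in $\mathbf{R}^d$ and $\mathrm{Cov}(B_i(s,t),B_j(u,v))=\min(s,u)\min(t,v)\delta_{i,j}$. $B^{-1}\{0\}=\{(s,t)\in\mathbf{R}_+^2: B(s,t)=0\}$ and $\dim_{\mathrm H}$ denotes Hausdorff dimension. *)

theory Defs
  imports "HOL-Analysis.Analysis" "HOL-Probability.Probability"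
begin

definition hd_gauge :: "real \<Rightarrow> 'a::metric_space set \<Rightarrow> real" where
  "hd_gauge \<alpha> U = (if U = {} then 0 else if \<alpha> = 0 then 1 else diameter U powr \<alpha>)"

definition hausdorff_pre :: "real \<Rightarrow> real \<Rightarrow> 'a::metric_space set \<Rightarrow> ennreal" where
  "hausdorff_pre \<alpha> \<delta> A =
     (INF U \<in> {U :: nat \<Rightarrow> 'a set. A \<subseteq> (\<Union>n. U n) \<and>
                 (\<forall>n. bounded (U n) \<and> diameter (U n) \<le> \<delta>)}.
        (\<Sum>n. ennreal (hd_gauge \<alpha> (U n))))"

definition hausdorff_measure :: "real \<Rightarrow> 'a::metric_space set \<Rightarrow> ennreal" where
  "hausdorff_measure \<alpha> A = (SUP \<delta> \<in> {0<..}. hausdorff_pre \<alpha> \<delta> A)"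

definition hausdorff_dim :: "'a::metric_space set \<Rightarrow> ereal" where
  "hausdorff_dim A = Inf {ereal \<alpha> | \<alpha>. \<alpha> \<ge> 0 \<and> hausdorff_measure \<alpha> A = 0}"

definition normal_rv :: "'w measure \<Rightarrow> ('w \<Rightarrow> real) \<Rightarrow> bool" where
  "normal_rv M X \<longleftrightarrow> X \<in> borel_measurable M \<and>
     (\<exists>\<mu> \<sigma>. (\<sigma> = 0 \<and> (AE x in M. X x = \<mu>)) \<or>
             (\<sigma> > 0 \<and> distributed M lborel X (normal_density \<mu> \<sigma>)))"

text \<open>B w (s,t) is the value of the sheet at parameter (s,t) in the sample point w;
  parameters are restricted to the quadrant s,t \<ge> 0. Gaussian process: every finite
  linear combination of coordinates is normally distributed. Centered, with covariance
  min(s,u) min(t,v) delta_ij, and all sample paths continuous.\<close>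
definition brownian_sheet :: "'w measure \<Rightarrow> ('w \<Rightarrow> real \<times> real \<Rightarrow> real ^ 'd) \<Rightarrow> bool" where
  "brownian_sheet M B \<longleftrightarrow>
     prob_space M \<and>
     (\<forall>w \<in> space M. continuous_on {p. fst p \<ge> 0 \<and> snd p \<ge> 0} (B w)) \<and>
     (\<forall>P c. finite P \<longrightarrow> P \<subseteq> {p. fst p \<ge> 0 \<and> snd p \<ge> 0} \<longrightarrow>
        normal_rv M (\<lambda>w. \<Sum>p\<in>P. \<Sum>i\<in>UNIV. c p i * B w p $ i)) \<and>
     (\<forall>s t i. s \<ge> 0 \<longrightarrow> t \<ge> 0 \<longrightarrow>
        integrable M (\<lambda>w. B w (s,t) $ i) \<and> (\<integral>w. B w (s,t) $ i \<partial>M) = 0) \<and>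
     (\<forall>s t u v i j. s \<ge> 0 \<longrightarrow> t \<ge> 0 \<longrightarrow> u \<ge> 0 \<longrightarrow> v \<ge> 0 \<longrightarrow>
        (\<integral>w. B w (s,t) $ i * B w (u,v) $ j \<partial>M) =
          min s u * min t v * (if i = j then 1 else 0))"

end

theory Submission
  imports Defs "HOL-Real_Asymp.Real_Asymp"
begin

text \<open>
  Fix two coordinates a, b and look at dyadic times of level n. By Kolmogorov chaining the
  sheet oscillates by at most r = C q^n on dyadic squares of side 2^(-n), where q is close to
  2^(-1/2); so a zero at (s,t) forces both coordinates to be at most r at the lower left corner
  of the dyadic square containing (s,t). For a fixed dyadic s the process t \<mapsto> B(s,t) is a
  Brownian motion, and the probability that a planar Brownian motion hits the r-square at m
  prescribed times is at most the product of const r^2 / (s gap) over the gaps between them.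
  Summing over m-subsets bounds the m-th binomial moment of the number of hits by the m-th power
  of a harmonic sum times r^2 2^n, which is only slightly exponential in n. For m large this beats
  the union bound over the order of 2^n dyadic values of s, so almost surely all slices
  simultaneously have covers by fewer than 2^(\<epsilon> n) intervals of length 2^(-n).
\<close>

section \<open>Centered Gaussian variables\<close>


text \<open>The obstacle is that one null set must serve uncountably many slices. A first-moment
  bound on the hits of one slice gains only a factor 2^(-\<epsilon> n), too little to pay for 2^n
  slices; moments of high order raise this gain to a power. Two coordinates are the critical number:
  each contributes r / sqrt (s gap), and the product of two sums over the gaps to a logarithm of the
  number of times, while one alone would sum to a square root. Zeros of the sheet are common zeros
  of any two coordinates. With \<beta> = 2 powr (-\<alpha>/4) the exponents are spaced by one
  \<beta>: r^2 2^n has order \<beta>^(-2n), the hit threshold is \<beta>^(-3n), and a segment of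
  length 2^(-n) has \<alpha>-gauge \<beta>^(4n). The first spacing drives the moment bound, the
  second makes the covering sum at most \<beta>^n. The windows [2^(-K), 2^K) keep s away from 0,
  where the slice degenerates, and the grids finite.\<close>

lemma integral_std_normal_exp_square:
  fixes v :: real
  assumes "v \<ge> 0"
  shows "(\<integral>z. exp (- (z\<^sup>2 * v) / 2) \<partial>std_normal_distribution) = 1 / sqrt (1 + v)"
proof -
  \<comment> \<open>Up to the factor \<open>\<sigma>\<close>, the integrand times the standard
    density is the centered normal density of variance 1 / (1 + v).\<close>
  define \<sigma> where "\<sigma> = 1 / sqrt (1 + v)"
  have s: "\<sigma> > 0" using assms by (simp add: \<sigma>_def)
  have s2: "\<sigma>\<^sup>2 = 1 / (1 + v)" using assms by (simp add: \<sigma>_def power_divide)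
  have eq: "std_normal_density z * exp (- (z\<^sup>2 * v) / 2) = \<sigma> * normal_density 0 \<sigma> z" for z
  proof -
    have "exp (- z\<^sup>2 / 2) * exp (- (z\<^sup>2 * v) / 2) = exp (- z\<^sup>2 / (2 * \<sigma>\<^sup>2))"
      unfolding s2 by (simp add: exp_add[symmetric] field_simps)
    moreover have "\<sigma> * (1 / sqrt (2 * pi * \<sigma>\<^sup>2)) = 1 / sqrt (2 * pi)"
      using s by (simp add: real_sqrt_mult)
    ultimately have "1 / sqrt (2 * pi) * (exp (- z\<^sup>2 / 2) * exp (- (z\<^sup>2 * v) / 2))
        = \<sigma> * (1 / sqrt (2 * pi * \<sigma>\<^sup>2)) * exp (- z\<^sup>2 / (2 * \<sigma>\<^sup>2))"
      by (simp only:)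
    then show ?thesis
      by (simp add: normal_density_def mult.assoc)
  qed
  have "(\<integral>z. exp (- (z\<^sup>2 * v) / 2) \<partial>std_normal_distribution)
      = (\<integral>z. std_normal_density z * exp (- (z\<^sup>2 * v) / 2) \<partial>lborel)"
    by (subst integral_density) (auto simp: normal_density_nonneg)
  also have "\<dots> = \<sigma>"
    unfolding eq using s by simp
  finally show ?thesis by (simp add: \<sigma>_def)
qed

context prob_space
begin

text \<open>A \<open>normal_rv\<close> may be degenerate, and the sheet does vanish almost surely at
  each point of the axes, so the constant case is carried along; centering turns the constant into
  0.\<close>

lemma centered_normal_cases:
  assumes "normal_rv M X" "expectation X = 0"
  obtains "AE w in M. X w = 0" | \<sigma> where "\<sigma> > 0" "distributed M lborel X (normal_density 0 \<sigma>)"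
proof -
  obtain \<mu> \<sigma> where X: "X \<in> borel_measurable M"
    and c: "(\<sigma> = 0 \<and> (AE x in M. X x = \<mu>)) \<or> (\<sigma> > 0 \<and> distributed M lborel X (normal_density \<mu> \<sigma>))"
    using assms(1) unfolding normal_rv_def by blast
  from c show ?thesis
  proof
    assume a: "\<sigma> = 0 \<and> (AE x in M. X x = \<mu>)"
    then have "expectation X = expectation (\<lambda>_. \<mu>)"
      using X by (intro integral_cong_AE) auto
    then have "\<mu> = 0" using assms(2) by (simp add: prob_space)
    with a that(1) show ?thesis by simp
  next
    assume a: "\<sigma> > 0 \<and> distributed M lborel X (normal_density \<mu> \<sigma>)"
    then have "expectation X = \<mu>"
      by (intro normal_distributed_expectation) auto
    with assms(2) a that(2) show ?thesis by auto
  qed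
qed

lemma centered_normal_moment_integrable:
  assumes "normal_rv M X" "expectation X = 0"
  shows "integrable M (\<lambda>w. X w ^ k)"
  using assms
proof (cases rule: centered_normal_cases)
  case 1
  then have "AE w in M. X w ^ k = 0 ^ k" by eventually_elim simp
  moreover have "X \<in> borel_measurable M" using assms by (auto simp: normal_rv_def)
  ultimately show ?thesis
    by (subst integrable_cong_AE[where g="\<lambda>_. 0 ^ k"]) auto
next
  case (2 \<sigma>)
  then show ?thesis
    using integrable_normal_moment[of \<sigma> 0 k] distributed_integrable[OF 2(2), of "\<lambda>x. x ^ k"]
    by simp
qed

text \<open>The constant is the double factorial (2k-1)!!. The order \<open>k\<close> stays free so
  that tail bounds of arbitrary polynomial order become available.\<close>

lemma centered_normal_moment_even:
  assumes "normal_rv M X" "expectation X = 0"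
  shows "expectation (\<lambda>w. X w ^ (2 * k)) = fact (2 * k) / (2 ^ k * fact k) * expectation (\<lambda>w. (X w)\<^sup>2) ^ k"
  using assms
proof (cases rule: centered_normal_cases)
  case 1
  have m: "X \<in> borel_measurable M" using assms by (auto simp: normal_rv_def)
  have "expectation (\<lambda>w. X w ^ j) = expectation (\<lambda>w. 0 ^ j)" for j
    using m 1 by (intro integral_cong_AE) auto
  then have "expectation (\<lambda>w. X w ^ j) = 0 ^ j" for j by (simp add: prob_space)
  then show ?thesis by (cases "k = 0") (auto simp: power_0_left prob_space)
next
  case (2 \<sigma>)
  have *: "expectation (\<lambda>w. X w ^ (2 * j)) = fact (2 * j) / ((2 / \<sigma>\<^sup>2) ^ j * fact j)" for j
    using integral_normal_moment_even[of \<sigma> 0 j] 2 distributed_integral[OF 2(2), of "\<lambda>x. x ^ (2 * j)"]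
    by simp
  have "expectation (\<lambda>w. (X w)\<^sup>2) = \<sigma>\<^sup>2" using *[of 1] by simp
  with *[of k] show ?thesis
    using 2(1) by (simp add: power_divide field_simps)
qed

lemma centered_normal_char:
  assumes "normal_rv M X" "expectation X = 0"
  shows "(CLINT w|M. iexp (X w)) = of_real (exp (- expectation (\<lambda>w. (X w)\<^sup>2) / 2))"
  using assms
proof (cases rule: centered_normal_cases)
  case 1
  have m: "X \<in> borel_measurable M" using assms by (auto simp: normal_rv_def)
  have "expectation (\<lambda>w. (X w)\<^sup>2) = expectation (\<lambda>w. 0)"
    using m 1 by (intro integral_cong_AE) auto
  moreover have "(CLINT w|M. iexp (X w)) = (CLINT w|M. 1)"
    using m 1 by (intro integral_cong_AE) auto
  ultimately show ?thesis by (simp add: prob_space)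
next
  case (2 \<sigma>)
  have m: "X \<in> borel_measurable M" using assms by (auto simp: normal_rv_def)
  have v: "expectation (\<lambda>w. (X w)\<^sup>2) = \<sigma>\<^sup>2"
    using integral_normal_moment_even[of \<sigma> 0 1] 2 distributed_integral[OF 2(2), of "\<lambda>x. x ^ 2"]
    by simp
  have d: "distributed M lborel (\<lambda>w. X w / \<sigma>) std_normal_density"
    using normal_standard_normal_convert[of \<sigma> X 0] 2 by simp
  have dd: "distr M borel (\<lambda>w. X w / \<sigma>) = std_normal_distribution"
    using distributed_distr_eq_density[OF d] by (simp cong: distr_cong)
  have "(CLINT w|M. iexp (X w)) = (CLINT w|M. iexp (\<sigma> * (X w / \<sigma>)))"
    using 2(1) by simp
  also have "\<dots> = (CLINT x|distr M borel (\<lambda>w. X w / \<sigma>). iexp (\<sigma> * x))"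
    using m by (subst integral_distr) auto
  also have "\<dots> = char std_normal_distribution \<sigma>"
    by (simp add: dd char_def)
  finally show ?thesis by (simp add: char_std_normal_distribution v)
qed

text \<open>
  Independence is never needed: writing \<open>exp (- x\<^sup>2 / 2)\<close> as the characteristic function of the standard
  normal law at \<open>x\<close> and applying Fubini moves one variable at a time from the product into the
  exponent, so that only the joint characteristic function of the \<open>X i\<close> enters.
\<close>

lemma expectation_prod_exp_neg_square:
  fixes X :: "'i \<Rightarrow> 'a \<Rightarrow> real" and v :: "'i \<Rightarrow> real"
  assumes I: "finite I" and [measurable]: "\<And>i. i \<in> I \<Longrightarrow> X i \<in> borel_measurable M"
    and v: "\<And>i. i \<in> I \<Longrightarrow> v i \<ge> 0"
    and ch: "\<And>c. (CLINT w|M. iexp (\<Sum>i\<in>I. c i * X i w)) = of_real (exp (- (\<Sum>i\<in>I. (c i)\<^sup>2 * v i) / 2))"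
    and S: "S \<subseteq> I"
  shows "(CLINT w|M. iexp (\<Sum>i\<in>I - S. c i * X i w) * of_real (\<Prod>i\<in>S. exp (- (X i w)\<^sup>2 / 2)))
    = of_real (exp (- (\<Sum>i\<in>I - S. (c i)\<^sup>2 * v i) / 2) * (\<Prod>i\<in>S. 1 / sqrt (1 + v i)))"
proof -
  have "finite S" using I S finite_subset by blast
  then show ?thesis using S
  proof (induction S arbitrary: c)
    case empty
    then show ?case using ch by simp
  next
    case (insert k S)
    let ?N = std_normal_distribution
    interpret N: prob_space ?N by (rule prob_space_normal_density) simp
    interpret P: pair_prob_space M ?N ..
    have kI: "k \<in> I" and kS: "k \<notin> S" and SI: "S \<subseteq> I" using insert by auto
    have IS: "I - S = insert k (I - insert k S)" "k \<notin> I - insert k S" "finite (I - insert k S)"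
      using kI kS I by auto
    define G where "G w = iexp (\<Sum>i\<in>I - insert k S. c i * X i w) * of_real (\<Prod>i\<in>S. exp (- (X i w)\<^sup>2 / 2))" for w
    have [measurable]: "G \<in> borel_measurable M"
    proof -
      have [measurable]: "X i \<in> borel_measurable M" if "i \<in> S" for i using that SI assms(2) by auto
      show ?thesis unfolding G_def
        by (intro borel_measurable_times borel_measurable_of_real borel_measurable_prod) measurable
    qed
    have [measurable]: "X k \<in> borel_measurable M" using kI by measurable
    have "norm (G w) \<le> 1" for w
    proof -
      have "(\<Prod>i\<in>S. exp (- (X i w)\<^sup>2 / 2)) \<le> 1"
        by (intro prod_le_1) auto
      moreover have "0 \<le> (\<Prod>i\<in>S. exp (- (X i w)\<^sup>2 / 2))"
        by (intro prod_nonneg) auto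
      ultimately show ?thesis
        unfolding G_def by (simp add: norm_mult del: of_real_prod)
    qed
    then have int: "integrable (M \<Otimes>\<^sub>M ?N) (\<lambda>(w, z). G w * iexp (X k w * z))"
      by (intro P.P.integrable_const_bound[where B=1]) (auto simp: norm_mult)
    have "(CLINT w|M. iexp (\<Sum>i\<in>I - insert k S. c i * X i w) * of_real (\<Prod>i\<in>insert k S. exp (- (X i w)\<^sup>2 / 2)))
      = (CLINT w|M. G w * char ?N (X k w))"
      unfolding G_def char_std_normal_distribution using insert(1,2)
      by (intro Bochner_Integration.integral_cong) (simp_all add: mult_ac)
    also have "\<dots> = (CLINT w|M. CLINT z|?N. G w * iexp (X k w * z))"
      by (simp add: char_def)
    also have "\<dots> = (CLINT z|?N. CLINT w|M. G w * iexp (X k w * z))"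
      using P.Fubini_integral[OF int] by simp
    also have "\<dots> = (CLINT z|?N. of_real (exp (- (z\<^sup>2 * v k) / 2) * (exp (- (\<Sum>i\<in>I - insert k S. (c i)\<^sup>2 * v i) / 2) * (\<Prod>i\<in>S. 1 / sqrt (1 + v i)))))"
    proof (intro Bochner_Integration.integral_cong refl)
      fix z
      \<comment> \<open>The integration variable \<open>z\<close> becomes the coefficient of
        \<open>X k\<close>; this is why the induction runs with \<open>c\<close> arbitrary.\<close>
      have e: "(\<Sum>i\<in>I - S. (c(k := z)) i * X i w) = X k w * z + (\<Sum>i\<in>I - insert k S. c i * X i w)" for w
        unfolding IS(1) using IS(2,3) by (subst sum.insert) (auto intro!: sum.cong simp: mult_ac)
      have e': "(\<Sum>i\<in>I - S. ((c(k := z)) i)\<^sup>2 * v i) = z\<^sup>2 * v k + (\<Sum>i\<in>I - insert k S. (c i)\<^sup>2 * v i)"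
        unfolding IS(1) using IS(2,3) by (subst sum.insert) (auto intro!: sum.cong)
      have "(CLINT w|M. G w * iexp (X k w * z)) =
         (CLINT w|M. iexp (\<Sum>i\<in>I - S. (c(k := z)) i * X i w) * of_real (\<Prod>i\<in>S. exp (- (X i w)\<^sup>2 / 2)))"
        unfolding e G_def of_real_add distrib_left exp_add by (simp only: mult_ac)
      also have "\<dots> = of_real (exp (- (z\<^sup>2 * v k) / 2) * (exp (- (\<Sum>i\<in>I - insert k S. (c i)\<^sup>2 * v i) / 2) * (\<Prod>i\<in>S. 1 / sqrt (1 + v i))))"
        unfolding insert.IH[OF SI] e' minus_add_distrib add_divide_distrib exp_add by (simp only: mult.assoc)
      finally show "(CLINT w|M. G w * iexp (X k w * z)) = \<dots>" .
    qed
    also have "\<dots> = of_real ((\<integral>z. exp (- (z\<^sup>2 * v k) / 2) \<partial>?N) * (exp (- (\<Sum>i\<in>I - insert k S. (c i)\<^sup>2 * v i) / 2) * (\<Prod>i\<in>S. 1 / sqrt (1 + v i))))"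
      unfolding integral_complex_of_real by simp
    also have "\<dots> = of_real (exp (- (\<Sum>i\<in>I - insert k S. (c i)\<^sup>2 * v i) / 2) * (\<Prod>i\<in>insert k S. 1 / sqrt (1 + v i)))"
      using integral_std_normal_exp_square[OF v[OF kI]] insert(1,2) by simp
    finally show ?case .
  qed
qed

text \<open>On [-r, r] the indicator is at most exp (1/2) times the weight exp (-(x/r)^2/2), and the
  expectation of the product of these weights is known exactly. The factor exp (1/2) per variable is
  harmless, since the number of variables will not grow with the dyadic level.\<close>

lemma prob_uncorrelated_gaussian_small:
  fixes X :: "'i \<Rightarrow> 'a \<Rightarrow> real" and v :: "'i \<Rightarrow> real"
  assumes I: "finite I" and m[measurable]: "\<And>i. i \<in> I \<Longrightarrow> X i \<in> borel_measurable M"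
    and v: "\<And>i. i \<in> I \<Longrightarrow> v i > 0" and r: "r > 0"
    and ch: "\<And>c. (CLINT w|M. iexp (\<Sum>i\<in>I. c i * X i w)) = of_real (exp (- (\<Sum>i\<in>I. (c i)\<^sup>2 * v i) / 2))"
  shows "prob {w\<in>space M. \<forall>i\<in>I. \<bar>X i w\<bar> \<le> r} \<le> (\<Prod>i\<in>I. exp (1/2) * r / sqrt (v i))"
proof -
  define Y where "Y i w = X i w / r" for i w
  have [measurable]: "Y i \<in> borel_measurable M" if "i \<in> I" for i
    using m[OF that] unfolding Y_def by measurable
  have ch': "(CLINT w|M. iexp (\<Sum>i\<in>I. c i * Y i w)) = of_real (exp (- (\<Sum>i\<in>I. (c i)\<^sup>2 * (v i / r\<^sup>2)) / 2))" for c
    using ch[of "\<lambda>i. c i / r"] by (simp add: Y_def power_divide)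
  \<comment> \<open>With \<open>S = I\<close> the oscillating exponent is empty and only the
    Gaussian weights remain.\<close>
  have "(CLINT w|M. of_real (\<Prod>i\<in>I. exp (- (Y i w)\<^sup>2 / 2))) = (of_real (\<Prod>i\<in>I. 1 / sqrt (1 + v i / r\<^sup>2)) :: complex)"
    using expectation_prod_exp_neg_square[OF I, of Y "\<lambda>i. v i / r\<^sup>2" I, OF _ _ ch'] less_imp_le[OF v] by simp
  then have E: "expectation (\<lambda>w. \<Prod>i\<in>I. exp (- (Y i w)\<^sup>2 / 2)) = (\<Prod>i\<in>I. 1 / sqrt (1 + v i / r\<^sup>2))"
    unfolding integral_complex_of_real of_real_eq_iff .
  have p1: "(\<Prod>i\<in>I. exp (- (Y i w)\<^sup>2 / 2)) \<le> 1" for w by (intro prod_le_1) auto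
  have p0: "0 \<le> (\<Prod>i\<in>I. exp (- (Y i w)\<^sup>2 / 2))" for w by (intro prod_nonneg) auto
  have int: "integrable M (\<lambda>w. \<Prod>i\<in>I. exp (- (Y i w)\<^sup>2 / 2))"
    using p0 p1 by (intro integrable_const_bound[where B=1]) auto
  let ?A = "{w\<in>space M. \<forall>i\<in>I. \<bar>X i w\<bar> \<le> r}"
  have [measurable]: "?A \<in> sets M" using I by measurable
  have "prob ?A = expectation (indicator ?A)" by simp
  also have "\<dots> \<le> expectation (\<lambda>w. (\<Prod>i\<in>I. exp (1/2)) * (\<Prod>i\<in>I. exp (- (Y i w)\<^sup>2 / 2)))"
  proof (rule integral_mono)
    show "integrable M (indicator ?A :: 'a \<Rightarrow> real)" by (simp add: emeasure_eq_measure)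
    show "integrable M (\<lambda>w. (\<Prod>i\<in>I. exp (1/2)) * (\<Prod>i\<in>I. exp (- (Y i w)\<^sup>2 / 2)))"
      using int by simp
    fix w
    show "indicator ?A w \<le> (\<Prod>i\<in>I. exp (1/2)) * (\<Prod>i\<in>I. exp (- (Y i w)\<^sup>2 / 2))"
    proof (cases "w \<in> ?A")
      case True
      have "1 \<le> exp (1/2) * exp (- (Y i w)\<^sup>2 / 2)" if "i \<in> I" for i
      proof -
        have "\<bar>Y i w\<bar> \<le> 1" using True that r by (auto simp: Y_def field_simps)
        then have "(Y i w)\<^sup>2 \<le> 1" by (simp add: abs_square_le_1)
        then show ?thesis by (simp add: exp_add[symmetric])
      qed
      then show ?thesis using True
        by (simp add: prod.distrib[symmetric] prod_ge_1 del: prod_constant)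
    qed (use p0 in \<open>auto intro!: mult_nonneg_nonneg prod_nonneg\<close>)
  qed
  also have "\<dots> = (\<Prod>i\<in>I. exp (1/2) * (1 / sqrt (1 + v i / r\<^sup>2)))"
    unfolding Bochner_Integration.integral_mult_right_zero E prod.distrib ..
  also have "\<dots> \<le> (\<Prod>i\<in>I. exp (1/2) * r / sqrt (v i))"
  proof (intro prod_mono conjI)
    fix i assume i: "i \<in> I"
    have "sqrt (v i) / r = sqrt (v i / r\<^sup>2)" using r by (simp add: real_sqrt_divide)
    also have "\<dots> \<le> sqrt (1 + v i / r\<^sup>2)" by simp
    finally have "1 / sqrt (1 + v i / r\<^sup>2) \<le> 1 / (sqrt (v i) / r)"
      using v[OF i] r by (intro divide_left_mono mult_pos_pos divide_pos_pos) (auto intro!: add_pos_pos)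
    from mult_left_mono[OF this, of "exp (1/2)"]
    show "exp (1/2) * (1 / sqrt (1 + v i / r\<^sup>2)) \<le> exp (1/2) * r / sqrt (v i)"
      by simp
    show "0 \<le> exp (1/2) * (1 / sqrt (1 + v i / r\<^sup>2))"
      using v[OF i] by (auto intro!: mult_nonneg_nonneg add_nonneg_nonneg)
  qed
  finally show ?thesis .
qed

end


section \<open>Subsets and their gaps\<close>

text \<open>The first gap is measured from time 0, where a slice of the sheet starts at the origin;
  thus m times yield m increments and m factors.\<close>

definition gap :: "nat set \<Rightarrow> nat \<Rightarrow> nat" where
  "gap A i = sorted_list_of_set A ! i - (if i = 0 then 0 else sorted_list_of_set A ! (i - 1))"

lemma sorted_list_of_set_nth_mono:
  fixes A :: "nat set"
  assumes "i < j" "j < card A"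
  shows "sorted_list_of_set A ! i < sorted_list_of_set A ! j"
  using assms sorted_wrt_nth_less[OF strict_sorted_list_of_set[of A]] by simp

lemma sorted_list_of_set_nth_mem:
  fixes A :: "nat set"
  assumes "i < card A"
  shows "sorted_list_of_set A ! i \<in> A"
proof -
  have "finite A" using assms card.infinite by fastforce
  then show ?thesis
    using nth_mem[of i "sorted_list_of_set A"] assms by simp
qed

lemma sum_gap:
  assumes "i < card A"
  shows "(\<Sum>l\<le>i. gap A l) = sorted_list_of_set A ! i"
  using assms
proof (induction i)
  case 0
  then show ?case by (simp add: gap_def)
next
  case (Suc i)
  then show ?case using sorted_list_of_set_nth_mono[of i "Suc i" A] by (simp add: gap_def)
qed

lemma gap_bounds:
  assumes "A \<subseteq> {1..J}" "i < card A"
  shows "gap A i \<in> {1..J}"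
proof -
  have "sorted_list_of_set A ! i \<in> {1..J}" using sorted_list_of_set_nth_mem[OF assms(2)] assms(1) by blast
  then show ?thesis
    using assms(2) sorted_list_of_set_nth_mono[of "i - 1" i A] by (auto simp: gap_def)
qed

text \<open>A set is recovered from its gaps as their partial sums, so subsets embed into all
  sequences of length \<open>m\<close> in {1..J}; the sum over all such sequences
  factorises.\<close>

lemma sum_subsets_prod_gap_le:
  fixes f :: "nat \<Rightarrow> real"
  assumes f: "\<And>g. f g \<ge> 0"
  shows "(\<Sum>A\<in>{A. A \<subseteq> {1..J} \<and> card A = m}. \<Prod>i<m. f (gap A i)) \<le> (\<Sum>g=1..J. f g) ^ m"
proof -
  let ?S = "{A. A \<subseteq> {1..J} \<and> card A = m}"
  let ?P = "PiE {..<m} (\<lambda>_. {1..J})"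
  define G where "G A = restrict (gap A) {..<m}" for A
  have "inj_on G ?S"
  proof (rule inj_onI)
    fix A B assume A: "A \<in> ?S" and B: "B \<in> ?S" and eq: "G A = G B"
    have "gap A l = gap B l" if "l < m" for l
      using fun_cong[OF eq, of l] that by (simp add: G_def)
    then have "sorted_list_of_set A ! i = sorted_list_of_set B ! i" if "i < m" for i
      using sum_gap[of i A] sum_gap[of i B] A B that by (auto intro!: sum.cong)
    then have "sorted_list_of_set A = sorted_list_of_set B"
      using A B by (intro nth_equalityI) auto
    moreover have "finite A" "finite B" using A B finite_subset by auto
    ultimately show "A = B" by (metis set_sorted_list_of_set)
  qed
  then have "(\<Sum>A\<in>?S. \<Prod>i<m. f (gap A i)) = (\<Sum>g\<in>G ` ?S. \<Prod>i<m. f (g i))"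
    by (subst sum.reindex) (simp_all add: G_def)
  also have "\<dots> \<le> (\<Sum>g\<in>?P. \<Prod>i<m. f (g i))"
  proof (rule sum_mono2)
    show "finite ?P" by (intro finite_PiE) auto
    show "G ` ?S \<subseteq> ?P"
    proof
      fix x assume "x \<in> G ` ?S"
      then obtain A where A: "A \<subseteq> {1..J}" "card A = m" "x = G A" by auto
      have "gap A i \<in> {1..J}" if "i < m" for i using gap_bounds[OF A(1)] A(2) that by simp
      then show "x \<in> ?P" unfolding A(3) G_def by (intro restrict_PiE_iff[THEN iffD2]) simp
    qed
  qed (use f in \<open>auto intro!: prod_nonneg\<close>)
  also have "\<dots> = (\<Sum>g=1..J. f g) ^ m"
    using prod_sum_PiE[of "{..<m}" "\<lambda>_. {1..J}" "\<lambda>_. f"] by simp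
  finally show ?thesis .
qed

section \<open>Hausdorff null sets\<close>

lemma hausdorff_measure_eq_0I:
  assumes "\<And>\<delta> \<epsilon>. \<delta> > 0 \<Longrightarrow> \<epsilon> > 0 \<Longrightarrow>
    \<exists>U. A \<subseteq> (\<Union>n. U n) \<and> (\<forall>n. bounded (U n) \<and> diameter (U n) \<le> \<delta>) \<and>
      (\<Sum>n. ennreal (hd_gauge \<alpha> (U n))) \<le> ennreal \<epsilon>"
  shows "hausdorff_measure \<alpha> A = 0"
proof -
  have "hausdorff_pre \<alpha> \<delta> A \<le> 0" if d: "\<delta> > 0" for \<delta>
  proof (rule ennreal_le_epsilon)
    fix e :: real assume "0 < e"
    from assms[OF d this] obtain U where U: "A \<subseteq> (\<Union>n. U n) \<and> (\<forall>n. bounded (U n) \<and> diameter (U n) \<le> \<delta>)"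
      "(\<Sum>n. ennreal (hd_gauge \<alpha> (U n))) \<le> ennreal e" by blast
    then show "hausdorff_pre \<alpha> \<delta> A \<le> 0 + ennreal e"
      unfolding hausdorff_pre_def by (auto intro!: INF_lower2[of U])
  qed
  then show ?thesis unfolding hausdorff_measure_def
    by (intro antisym SUP_least) auto
qed

lemma hausdorff_measure_eq_0D:
  assumes "hausdorff_measure \<alpha> A = 0" "\<delta> > 0" "\<epsilon> > 0"
  shows "\<exists>U. A \<subseteq> (\<Union>n. U n) \<and> (\<forall>n. bounded (U n) \<and> diameter (U n) \<le> \<delta>) \<and>
      (\<Sum>n. ennreal (hd_gauge \<alpha> (U n))) \<le> ennreal \<epsilon>"
proof -
  have "hausdorff_pre \<alpha> \<delta> A \<le> hausdorff_measure \<alpha> A"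
    unfolding hausdorff_measure_def using assms(2) by (intro SUP_upper) auto
  then have "hausdorff_pre \<alpha> \<delta> A < ennreal \<epsilon>" using assms by simp
  then show ?thesis unfolding hausdorff_pre_def INF_less_iff by (auto intro: less_imp_le)
qed

text \<open>The pieces get the budgets \<epsilon>/2, \<epsilon>/4, ..., and their covers are merged
  by a pairing function. This later passes from bounded windows to a whole slice.\<close>

lemma hausdorff_measure_UN_eq_0:
  fixes A :: "nat \<Rightarrow> 'a::metric_space set"
  assumes "\<And>k. hausdorff_measure \<alpha> (A k) = 0"
  shows "hausdorff_measure \<alpha> (\<Union>k. A k) = 0"
proof (rule hausdorff_measure_eq_0I)
  fix \<delta> \<epsilon> :: real assume d: "\<delta> > 0" and e: "\<epsilon> > 0"
  have "\<exists>U. A k \<subseteq> (\<Union>n. U n) \<and> (\<forall>n. bounded (U n) \<and> diameter (U n) \<le> \<delta>) \<and>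
      (\<Sum>n. ennreal (hd_gauge \<alpha> (U n))) \<le> ennreal (\<epsilon> * (1/2) ^ Suc k)" for k
    using e by (intro hausdorff_measure_eq_0D assms d) auto
  then obtain U where U: "A k \<subseteq> (\<Union>n. U k n)" "bounded (U k n)" "diameter (U k n) \<le> \<delta>"
      "(\<Sum>n. ennreal (hd_gauge \<alpha> (U k n))) \<le> ennreal (\<epsilon> * (1/2) ^ Suc k)" for k n
    by metis
  define V where "V i = (case prod_decode i of (k, n) \<Rightarrow> U k n)" for i
  have "(\<Union>k. A k) \<subseteq> (\<Union>i. V i)"
  proof
    fix x assume "x \<in> (\<Union>k. A k)"
    then obtain k n where "x \<in> U k n" using U(1) by blast
    then have "x \<in> V (prod_encode (k, n))" by (simp add: V_def)
    then show "x \<in> (\<Union>i. V i)" by blast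
  qed
  moreover have "bounded (V i) \<and> diameter (V i) \<le> \<delta>" for i
    using U by (simp add: V_def split: prod.split)
  moreover have "(\<Sum>i. ennreal (hd_gauge \<alpha> (V i))) \<le> ennreal \<epsilon>"
  proof -
    have "(\<Sum>i. ennreal (hd_gauge \<alpha> (V i))) = (\<Sum>i. (\<lambda>(k, n). ennreal (hd_gauge \<alpha> (U k n))) (prod_decode i))"
      by (intro suminf_cong) (simp add: V_def split: prod.split)
    also have "\<dots> = (\<Sum>k. \<Sum>n. ennreal (hd_gauge \<alpha> (U k n)))"
      by (rule suminf_ennreal_2dimen) simp
    also have "\<dots> \<le> (\<Sum>k. ennreal (\<epsilon> * (1/2) ^ Suc k))"
      by (intro suminf_le U) auto
    also have "\<dots> = ennreal (\<Sum>k. \<epsilon> * (1/2) ^ Suc k)"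
      using e sums_mult[OF power_half_series, of \<epsilon>] by (intro suminf_ennreal2) (auto simp: sums_iff)
    also have "(\<Sum>k. \<epsilon> * (1/2) ^ Suc k) = \<epsilon>"
      using sums_mult[OF power_half_series, of \<epsilon>] by (simp add: sums_iff)
    finally show ?thesis .
  qed
  ultimately show "\<exists>U. (\<Union>k. A k) \<subseteq> (\<Union>n. U n) \<and> (\<forall>n. bounded (U n) \<and> diameter (U n) \<le> \<delta>) \<and>
      (\<Sum>n. ennreal (hd_gauge \<alpha> (U n))) \<le> ennreal \<epsilon>" by blast
qed

text \<open>A hit count provides finite covers of a single scale \<open>h\<close>. They are padded
  with empty sets, whose gauge is 0; \<open>\<alpha> > 0\<close> keeps away from the convention that
  every nonempty set has gauge 1.\<close>

lemma hausdorff_measure_eq_0_finite_covers: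
  fixes A :: "'a::metric_space set"
  assumes "\<alpha> > 0"
    and "\<And>\<delta> \<epsilon>. \<delta> > 0 \<Longrightarrow> \<epsilon> > 0 \<Longrightarrow>
      \<exists>(I :: nat set) U h. finite I \<and> A \<subseteq> (\<Union>i\<in>I. U i) \<and> h \<le> \<delta> \<and>
        (\<forall>i\<in>I. bounded (U i) \<and> diameter (U i) \<le> h) \<and> card I * h powr \<alpha> \<le> \<epsilon>"
  shows "hausdorff_measure \<alpha> A = 0"
proof (rule hausdorff_measure_eq_0I)
  fix \<delta> \<epsilon> :: real assume d: "\<delta> > 0" and e: "\<epsilon> > 0"
  from assms(2)[OF this] obtain I :: "nat set" and U h where U: "finite I" "A \<subseteq> (\<Union>i\<in>I. U i)" "h \<le> \<delta>"
    "\<And>i. i \<in> I \<Longrightarrow> bounded (U i)" "\<And>i. i \<in> I \<Longrightarrow> diameter (U i) \<le> h" "card I * h powr \<alpha> \<le> \<epsilon>"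
    by blast
  define V where "V i = (if i \<in> I then U i else {})" for i
  have "A \<subseteq> (\<Union>n. V n)" using U(2) by (force simp: V_def)
  moreover have "bounded (V n) \<and> diameter (V n) \<le> \<delta>" for n
    using U(3-5) d by (force simp: V_def)
  moreover have "(\<Sum>n. ennreal (hd_gauge \<alpha> (V n))) \<le> ennreal \<epsilon>"
  proof -
    have "(\<Sum>n. ennreal (hd_gauge \<alpha> (V n))) = (\<Sum>n\<in>I. ennreal (hd_gauge \<alpha> (V n)))"
      by (intro suminf_finite U(1)) (simp add: V_def hd_gauge_def)
    also have "\<dots> \<le> (\<Sum>n\<in>I. ennreal (h powr \<alpha>))"
      using assms(1) U(4,5) by (intro sum_mono ennreal_leI)
        (auto simp: V_def hd_gauge_def diameter_ge_0 intro!: powr_mono2)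
    also have "\<dots> = ennreal (card I * h powr \<alpha>)"
      by (simp add: ennreal_mult ennreal_of_nat_eq_real_of_nat)
    also have "\<dots> \<le> ennreal \<epsilon>" by (intro ennreal_leI U(6))
    finally show ?thesis .
  qed
  ultimately show "\<exists>U. A \<subseteq> (\<Union>n. U n) \<and> (\<forall>n. bounded (U n) \<and> diameter (U n) \<le> \<delta>) \<and>
      (\<Sum>n. ennreal (hd_gauge \<alpha> (U n))) \<le> ennreal \<epsilon>" by blast
qed

lemma hausdorff_dim_eq_0I:
  assumes "\<And>e. e > 0 \<Longrightarrow> \<exists>\<alpha>. 0 \<le> \<alpha> \<and> \<alpha> < e \<and> hausdorff_measure \<alpha> A = 0"
  shows "hausdorff_dim A = 0"
proof (rule antisym)
  show "0 \<le> hausdorff_dim A" unfolding hausdorff_dim_def by (intro Inf_greatest) auto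
  have "hausdorff_dim A \<le> ereal e" if "e > 0" for e
  proof -
    from assms[OF that] obtain \<alpha> where "0 \<le> \<alpha>" "\<alpha> < e" "hausdorff_measure \<alpha> A = 0" by blast
    then show ?thesis unfolding hausdorff_dim_def by (intro Inf_lower2[of "ereal \<alpha>"]) auto
  qed
  then show "hausdorff_dim A \<le> 0"
    using ereal_le_epsilon2[of "hausdorff_dim A" 0] by simp
qed


section \<open>Hitting probabilities of a slice\<close>

locale sheet =
  fixes M :: "'w measure" and B :: "'w \<Rightarrow> real \<times> real \<Rightarrow> real ^ 'd"
  assumes sheet: "brownian_sheet M B"

sublocale sheet \<subseteq> prob_space M
  using sheet by (simp add: brownian_sheet_def)

context sheet
begin

text \<open>The linear Gaussian space of the sheet. Each element is centered normal, so joint laws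
  inside it are determined by covariances alone.\<close>

definition gspan :: "('w \<Rightarrow> real) set" where
  "gspan = {Y. \<exists>P c. finite P \<and> P \<subseteq> {p. fst p \<ge> 0 \<and> snd p \<ge> 0} \<and>
     Y = (\<lambda>w. \<Sum>p\<in>P. \<Sum>i\<in>UNIV. c p i * B w p $ i)}"

lemma gspan_coord:
  assumes "s \<ge> 0" "t \<ge> 0"
  shows "(\<lambda>w. B w (s, t) $ a) \<in> gspan"
  unfolding gspan_def
proof (intro CollectI exI conjI)
  show "(\<lambda>w. B w (s, t) $ a) = (\<lambda>w. \<Sum>p\<in>{(s, t)}. \<Sum>i\<in>UNIV. (if i = a then 1 else 0) * B w p $ i)"
    by (simp add: if_distrib[where f="\<lambda>x. x * _"] cong: if_cong)
qed (use assms in auto)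

lemma gspan_lincomb:
  assumes "X \<in> gspan" "Y \<in> gspan"
  shows "(\<lambda>w. x * X w + y * Y w) \<in> gspan"
proof -
  let ?Q = "{p :: real \<times> real. fst p \<ge> 0 \<and> snd p \<ge> 0}"
  obtain P c where P: "finite P" "P \<subseteq> ?Q" "X = (\<lambda>w. \<Sum>p\<in>P. \<Sum>i\<in>UNIV. c p i * B w p $ i)"
    using assms(1) unfolding gspan_def by blast
  obtain R d where R: "finite R" "R \<subseteq> ?Q" "Y = (\<lambda>w. \<Sum>p\<in>R. \<Sum>i\<in>UNIV. d p i * B w p $ i)"
    using assms(2) unfolding gspan_def by blast
  define e where "e p i = x * (if p \<in> P then c p i else 0) + y * (if p \<in> R then d p i else 0)" for p i
  have "(\<lambda>w. x * X w + y * Y w) = (\<lambda>w. \<Sum>p\<in>P \<union> R. \<Sum>i\<in>UNIV. e p i * B w p $ i)"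
  proof
    fix w
    have X: "X w = (\<Sum>p\<in>P \<union> R. \<Sum>i\<in>UNIV. (if p \<in> P then c p i else 0) * B w p $ i)"
      unfolding P(3) using P(1) R(1) by (intro sum.mono_neutral_cong_left) auto
    have Y: "Y w = (\<Sum>p\<in>P \<union> R. \<Sum>i\<in>UNIV. (if p \<in> R then d p i else 0) * B w p $ i)"
      unfolding R(3) using P(1) R(1) by (intro sum.mono_neutral_cong_left) auto
    show "x * X w + y * Y w = (\<Sum>p\<in>P \<union> R. \<Sum>i\<in>UNIV. e p i * B w p $ i)"
      unfolding X Y e_def by (simp add: sum_distrib_left sum.distrib distrib_right mult.assoc)
  qed
  moreover have "finite (P \<union> R)" "P \<union> R \<subseteq> ?Q" using P R by auto
  ultimately show ?thesis unfolding gspan_def by blast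
qed

lemma gspan_zero: "(\<lambda>w. 0) \<in> gspan"
  unfolding gspan_def by (auto intro!: exI[of _ "{}"])

lemma gspan_diff: "X \<in> gspan \<Longrightarrow> Y \<in> gspan \<Longrightarrow> (\<lambda>w. X w - Y w) \<in> gspan"
  using gspan_lincomb[of X Y 1 "-1"] by simp

lemma gspan_sum:
  assumes "finite I" "\<And>i. i \<in> I \<Longrightarrow> X i \<in> gspan"
  shows "(\<lambda>w. \<Sum>i\<in>I. c i * X i w) \<in> gspan"
  using assms
proof (induction I)
  case empty
  then show ?case by (simp add: gspan_zero)
next
  case (insert k I)
  then show ?case using gspan_lincomb[of "X k" "\<lambda>w. \<Sum>i\<in>I. c i * X i w" "c k" 1] by simp
qed

lemma gspan_normal:
  assumes "Y \<in> gspan"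
  shows "normal_rv M Y" "expectation Y = 0"
proof -
  obtain P c where P: "finite P" "P \<subseteq> {p. fst p \<ge> 0 \<and> snd p \<ge> 0}"
    "Y = (\<lambda>w. \<Sum>p\<in>P. \<Sum>i\<in>UNIV. c p i * B w p $ i)"
    using assms unfolding gspan_def by blast
  show "normal_rv M Y" using sheet P unfolding brownian_sheet_def by blast
  have i: "integrable M (\<lambda>w. B w p $ i)" "expectation (\<lambda>w. B w p $ i) = 0" if "p \<in> P" for p i
  proof -
    have "fst p \<ge> 0" "snd p \<ge> 0" using that P(2) by auto
    then have "integrable M (\<lambda>w. B w (fst p, snd p) $ i) \<and> expectation (\<lambda>w. B w (fst p, snd p) $ i) = 0"
      using sheet unfolding brownian_sheet_def by blast
    then show "integrable M (\<lambda>w. B w p $ i)" "expectation (\<lambda>w. B w p $ i) = 0" by auto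
  qed
  show "expectation Y = 0"
    unfolding P(3) using i by (subst Bochner_Integration.integral_sum) auto
qed

lemma gspan_measurable: "Y \<in> gspan \<Longrightarrow> Y \<in> borel_measurable M"
  using gspan_normal(1) by (auto simp: normal_rv_def)

text \<open>Polarisation reduces the product to squares, which are Gaussian moments.\<close>

lemma gspan_integrable_mult:
  assumes "X \<in> gspan" "Y \<in> gspan"
  shows "integrable M (\<lambda>w. X w * Y w)"
proof -
  have sq: "integrable M (\<lambda>w. (Z w)\<^sup>2)" if "Z \<in> gspan" for Z
    using centered_normal_moment_integrable gspan_normal[OF that] by blast
  have "(\<lambda>w. X w + Y w) \<in> gspan" using gspan_lincomb[OF assms, of 1 1] by simp
  then have "integrable M (\<lambda>w. ((X w + Y w)\<^sup>2 - (X w)\<^sup>2 - (Y w)\<^sup>2) / 2)"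
    by (intro integrable_divide Bochner_Integration.integrable_diff sq assms)
  then show ?thesis by (simp add: power2_sum mult.assoc)
qed

lemma cov:
  assumes "s \<ge> 0" "t \<ge> 0" "u \<ge> 0" "v \<ge> 0"
  shows "expectation (\<lambda>w. B w (s, t) $ i * B w (u, v) $ j) = min s u * min t v * (if i = j then 1 else 0)"
  using sheet assms unfolding brownian_sheet_def by blast

lemma gspan_cov_diff:
  assumes "X \<in> gspan" "Y \<in> gspan" "X' \<in> gspan" "Y' \<in> gspan"
  shows "expectation (\<lambda>w. (X w - Y w) * (X' w - Y' w)) =
    expectation (\<lambda>w. X w * X' w) - expectation (\<lambda>w. X w * Y' w) - (expectation (\<lambda>w. Y w * X' w) - expectation (\<lambda>w. Y w * Y' w))"
  using assms by (simp add: left_diff_distrib right_diff_distrib gspan_integrable_mult)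

text \<open>The linear combination is again centered normal, so its characteristic function depends
  only on its variance, which is diagonal for uncorrelated variables. This supplies the hypothesis
  of \<open>prob_uncorrelated_gaussian_small\<close>.\<close>

lemma gspan_char_uncorrelated:
  assumes "finite I" and X: "\<And>i. i \<in> I \<Longrightarrow> X i \<in> gspan"
    and v: "\<And>i. i \<in> I \<Longrightarrow> expectation (\<lambda>w. X i w * X i w) = v i"
    and uncor: "\<And>i j. i \<in> I \<Longrightarrow> j \<in> I \<Longrightarrow> i \<noteq> j \<Longrightarrow> expectation (\<lambda>w. X i w * X j w) = 0"
  shows "(CLINT w|M. iexp (\<Sum>i\<in>I. c i * X i w)) = of_real (exp (- (\<Sum>i\<in>I. (c i)\<^sup>2 * v i) / 2))"
proof -
  let ?Y = "\<lambda>w. \<Sum>i\<in>I. c i * X i w"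
  have Y: "?Y \<in> gspan" by (rule gspan_sum[OF assms(1) X])
  have "expectation (\<lambda>w. (?Y w)\<^sup>2) = expectation (\<lambda>w. \<Sum>i\<in>I. \<Sum>j\<in>I. c i * c j * (X i w * X j w))"
    by (simp add: power2_eq_square sum_product mult_ac)
  also have "\<dots> = (\<Sum>i\<in>I. \<Sum>j\<in>I. c i * c j * expectation (\<lambda>w. X i w * X j w))"
    using X by (simp add: Bochner_Integration.integral_sum gspan_integrable_mult)
  also have "\<dots> = (\<Sum>i\<in>I. \<Sum>j\<in>I. if j = i then (c i)\<^sup>2 * v i else 0)"
    using v uncor by (intro sum.cong refl) (auto simp: power2_eq_square)
  also have "\<dots> = (\<Sum>i\<in>I. (c i)\<^sup>2 * v i)" using assms(1) by simp
  finally show ?thesis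
    using centered_normal_char[OF gspan_normal[OF Y]] by simp
qed

text \<open>\<open>s\<close> is the slice, \<open>h\<close> the time step, \<open>r\<close> the
  radius and \<open>J\<close> the number of steps. Counting starts at 1 because time 0 would almost
  surely be a hit and because all gaps must be positive.\<close>

definition hits :: "'d \<Rightarrow> 'd \<Rightarrow> real \<Rightarrow> real \<Rightarrow> real \<Rightarrow> nat \<Rightarrow> 'w \<Rightarrow> nat set" where
  "hits a b s h r J w = {j \<in> {1..J}. \<bar>B w (s, real j * h) $ a\<bar> \<le> r \<and> \<bar>B w (s, real j * h) $ b\<bar> \<le> r}"

text \<open>If both coordinates are at most \<open>r\<close> at all times in \<open>A\<close>, their
  increments between consecutive times are at most \<open>2 * r\<close>. These increments are
  uncorrelated, with variance s h gap.\<close>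

lemma prob_subset_hits_le:
  assumes ab: "a \<noteq> b" and s: "s > 0" and h: "h > 0" and r: "r > 0"
    and A: "A \<subseteq> {1..J}" "card A = m"
  shows "prob {w \<in> space M. A \<subseteq> hits a b s h r J w} \<le> (\<Prod>i<m. exp 1 * (2 * r)\<^sup>2 / (s * h * gap A i))"
proof -
  define x where "x i = sorted_list_of_set A ! i" for i
  define y where "y i = (if i = 0 then 0 else x (i - 1))" for i
  \<comment> \<open>\<open>B w (s, 0)\<close> is 0 only almost surely; setting the value to 0
    outright makes the event inclusion below hold for every \<open>w\<close> and leaves the
    covariances unchanged.\<close>
  define Z where "Z c j w = (if j = 0 then 0 else B w (s, real j * h) $ c)" for c j w
  define X where "X = (\<lambda>(c, i) w. Z c (x i) w - Z c (y i) w)"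
  define v where "v = (\<lambda>(c :: 'd, i). s * h * gap A i)"
  let ?I = "{a, b} \<times> {..<m}"
  have Z: "Z c j \<in> gspan" for c j
    using gspan_coord[of s "real j * h" c] gspan_zero s h by (cases "j = 0") (auto simp: Z_def[abs_def])
  have covZ: "expectation (\<lambda>w. Z c j w * Z d k w) = s * h * min j k * (if c = d then 1 else 0)" for c d j k
  proof -
    have "min (real j * h) (real k * h) = h * min j k" using h by (auto simp: min_def mult_ac)
    then show ?thesis
      using s h cov[of s "real j * h" s "real k * h" c d]
      by (cases "j = 0 \<or> k = 0") (auto simp: Z_def mult_ac)
  qed
  have Xg: "X p \<in> gspan" for p unfolding X_def by (cases p) (auto intro!: gspan_diff Z)
  have mono: "x i < x j" if "i < j" "j < m" for i j
    using sorted_list_of_set_nth_mono that A(2) by (simp add: x_def)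
  have yx: "y i \<le> x i" if "i < m" for i
    using mono[of "i - 1" i] that by (auto simp: y_def)
  have xy: "x i \<le> y j" if "i < j" "j < m" for i j
  proof (cases "i = j - 1")
    case False
    then have "i < j - 1" "j - 1 < m" using that by auto
    from mono[OF this] that show ?thesis by (simp add: y_def)
  qed (use that in \<open>simp add: y_def\<close>)
  have yy: "y i \<le> y j" if "i < j" "j < m" for i j
    using xy[OF that] yx[of i] that by simp
  have gap: "gap A i = x i - y i" for i by (simp add: gap_def x_def y_def)
  have gap_pos: "gap A i > 0" if "i < m" for i using gap_bounds[OF A(1), of i] A(2) that by simp
  have covX: "expectation (\<lambda>w. X (c, i) w * X (d, j) w) =
    s * h * (if c = d then 1 else 0) * (real (min (x i) (x j)) - real (min (x i) (y j)) - (real (min (y i) (x j)) - real (min (y i) (y j))))" for c d i j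
    unfolding X_def prod.case by (subst gspan_cov_diff[OF Z Z Z Z]) (simp add: covZ algebra_simps)
  have var: "expectation (\<lambda>w. X p w * X p w) = v p" if "p \<in> ?I" for p
  proof -
    obtain c i where p: "p = (c, i)" "i < m" using \<open>p \<in> ?I\<close> by auto
    show ?thesis unfolding p(1) covX v_def gap using yx[OF p(2)] by (simp add: min_def of_nat_diff)
  qed
  \<comment> \<open>For i < j the time intervals do not overlap (\<open>x i \<le> y j\<close>), so
    the four minima cancel in pairs; for equal indices the coordinates differ.\<close>
  have uncor: "expectation (\<lambda>w. X p w * X q w) = 0" if pq: "p \<in> ?I" "q \<in> ?I" "p \<noteq> q" for p q
  proof -
    obtain c i where p: "p = (c, i)" "i < m" using pq(1) by auto
    obtain d j where q: "q = (d, j)" "j < m" using pq(2) by auto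
    note p = p q
    have "i < j \<or> j < i \<or> i = j" by auto
    then show ?thesis
    proof (elim disjE)
      assume "i < j"
      then show ?thesis unfolding p(1,3) covX
        using mono[of i j] xy[of i j] yy[of i j] yx[of i] yx[of j] p by (simp add: min_def)
    next
      assume "j < i"
      then show ?thesis unfolding p(1,3) covX
        using mono[of j i] xy[of j i] yy[of j i] yx[of i] yx[of j] p by (simp add: min_def)
    next
      assume "i = j"
      then have "c \<noteq> d" using pq p by auto
      then show ?thesis unfolding p(1,3) covX by simp
    qed
  qed
  have fin: "finite ?I" by simp
  have "prob {w \<in> space M. A \<subseteq> hits a b s h r J w} \<le> prob {w\<in>space M. \<forall>p\<in>?I. \<bar>X p w\<bar> \<le> 2 * r}"
  proof (rule finite_measure_mono)
    have [measurable]: "X p \<in> borel_measurable M" for p using Xg gspan_measurable by blast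
    show "{w\<in>space M. \<forall>p\<in>?I. \<bar>X p w\<bar> \<le> 2 * r} \<in> events"
      using fin by measurable
    show "{w \<in> space M. A \<subseteq> hits a b s h r J w} \<subseteq> {w\<in>space M. \<forall>p\<in>?I. \<bar>X p w\<bar> \<le> 2 * r}"
    proof (intro subsetI CollectI conjI ballI)
      fix w assume w': "w \<in> {w \<in> space M. A \<subseteq> hits a b s h r J w}"
      then show "w \<in> space M" by simp
      have w: "A \<subseteq> hits a b s h r J w" using w' by simp
      fix p assume p: "p \<in> ?I"
      obtain c i where ci: "p = (c, i)" and c: "c \<in> {a, b}" and i: "i \<in> {..<m}" using p by blast
      have Zr: "\<bar>Z c j w\<bar> \<le> r" if "j \<in> A \<or> j = 0" for j
        using w c that r by (auto simp: Z_def hits_def)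
      have "x k \<in> A" if "k < m" for k using sorted_list_of_set_nth_mem that A(2) by (simp add: x_def)
      then have "x i \<in> A" "y i \<in> A \<or> y i = 0" using i by (auto simp: y_def)
      then have "\<bar>Z c (x i) w\<bar> \<le> r" "\<bar>Z c (y i) w\<bar> \<le> r" using Zr by auto
      then show "\<bar>X p w\<bar> \<le> 2 * r" unfolding X_def ci by simp
    qed
  qed
  also have "\<dots> \<le> (\<Prod>p\<in>?I. exp (1/2) * (2 * r) / sqrt (v p))"
  proof (rule prob_uncorrelated_gaussian_small[OF fin])
    show "v p > 0" if "p \<in> ?I" for p using that gap_pos s h by (auto simp: v_def)
    show "(CLINT w|M. iexp (\<Sum>i\<in>?I. c i * X i w)) = of_real (exp (- (\<Sum>i\<in>?I. (c i)\<^sup>2 * v i) / 2))" for c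
      by (rule gspan_char_uncorrelated[OF fin Xg var uncor])
  qed (use Xg gspan_measurable r in auto)
  also have "\<dots> = (\<Prod>c\<in>{a, b}. \<Prod>i<m. exp (1/2) * (2 * r) / sqrt (s * h * gap A i))"
    unfolding prod.cartesian_product by (intro prod.cong) (auto simp: v_def)
  \<comment> \<open>The second coordinate squares the factor and removes the root, which leaves
    1/gap and hence a harmonic sum.\<close>
  also have "\<dots> = (\<Prod>i<m. (exp (1/2) * (2 * r) / sqrt (s * h * gap A i))\<^sup>2)"
    using ab by (simp add: power2_eq_square prod.distrib[symmetric])
  also have "\<dots> = (\<Prod>i<m. exp 1 * (2 * r)\<^sup>2 / (s * h * gap A i))"
    using s h by (intro prod.cong refl) (simp add: power_divide power_mult_distrib exp_double[symmetric])
  finally show ?thesis .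
qed

end


section \<open>Binomial moments of the number of hits on one slice\<close>

context sheet
begin

lemma hits_event:
  assumes "s > 0" "h > 0"
  shows "{w \<in> space M. j \<in> hits a b s h r J w} \<in> events"
proof -
  have [measurable]: "(\<lambda>w. B w (s, real j * h) $ c) \<in> borel_measurable M" for c
    using gspan_coord[of s "real j * h" c] gspan_measurable assms by simp
  show ?thesis unfolding hits_def by simp
qed

lemma subset_hits_event:
  assumes "s > 0" "h > 0" "finite A"
  shows "{w \<in> space M. A \<subseteq> hits a b s h r J w} \<in> events"
proof -
  have "{w \<in> space M. \<forall>j\<in>A. j \<in> hits a b s h r J w} \<in> events"
    using assms by (intro sets.sets_Collect_finite_All hits_event) auto
  then show ?thesis by (simp add: subset_iff Ball_def)
qed

text \<open>At least \<open>L\<close> hits contain at least (L/m)^m subsets of size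
  \<open>m\<close>; \<open>L \<ge> real m\<close> is what permits this lower bound for the binomial
  coefficient. The expected number of such subsets is at most the m-th power of the sum over gaps,
  so the whole estimate is an m-th power.\<close>

lemma prob_card_hits_ge:
  assumes ab: "a \<noteq> b" and s: "s > 0" and h: "h > 0" and r: "r > 0" and m: "m > 0" and L: "L \<ge> real m"
  shows "{w \<in> space M. real (card (hits a b s h r J w)) \<ge> L} \<in> events" (is ?ev)
    and "prob {w \<in> space M. real (card (hits a b s h r J w)) \<ge> L}
      \<le> ((\<Sum>g=1..J. exp 1 * (2 * r)\<^sup>2 / (s * h * real g)) * m / L) ^ m" (is ?le)
proof -
  let ?D = "hits a b s h r J"
  let ?S = "{A. A \<subseteq> {1..J} \<and> card A = m}"
  let ?E = "\<lambda>A. {w \<in> space M. A \<subseteq> ?D w}"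
  let ?F = "\<Sum>g=1..J. exp 1 * (2 * r)\<^sup>2 / (s * h * real g)"
  have finS: "finite ?S" by simp
  have sub: "?D w \<subseteq> {1..J}" for w by (auto simp: hits_def)
  have fin: "finite (?D w)" for w using sub finite_subset by blast
  have ev: "?E A \<in> events" if "A \<in> ?S" for A
    using that finite_subset[of A "{1..J}"] by (intro subset_hits_event s h) auto
  have "card (?D w) = (\<Sum>j=1..J. of_bool (j \<in> ?D w))" for w
  proof -
    have "{1..J} \<inter> ?D w = ?D w" using sub by blast
    then show ?thesis by (simp add: of_bool_def sum.If_cases)
  qed
  then have c: "real (card (?D w)) = (\<Sum>j=1..J. indicator {w \<in> space M. j \<in> ?D w} w)" if "w \<in> space M" for w
    using that by (simp add: indicator_def of_bool_def if_distrib[of real] cong: if_cong)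
  have [measurable]: "{w \<in> space M. j \<in> ?D w} \<in> events" for j by (rule hits_event[OF s h])
  have "{w \<in> space M. real (card (?D w)) \<ge> L} = {w \<in> space M. (\<Sum>j=1..J. indicator {w \<in> space M. j \<in> ?D w} w) \<ge> L}"
    using c by auto
  also have "\<dots> \<in> events" by measurable
  finally show ev': ?ev .
  \<comment> \<open>Markov's inequality for the number of \<open>m\<close>-subsets of the hit set\<close>
  have choose: "real (card (?D w) choose m) = (\<Sum>A\<in>?S. indicator (?E A) w)" if "w \<in> space M" for w
  proof -
    have "(\<Sum>A\<in>?S. indicator (?E A) w) = (\<Sum>A\<in>?S. if A \<subseteq> ?D w then 1 else 0 :: real)"
      using that by (intro sum.cong) (auto simp: indicator_def)
    also have "\<dots> = real (card (?S \<inter> {A. A \<subseteq> ?D w}))"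
      using finS by (simp add: sum.If_cases)
    also have "?S \<inter> {A. A \<subseteq> ?D w} = {A. A \<subseteq> ?D w \<and> card A = m}" using sub by blast
    finally show ?thesis using n_subsets[OF fin] by simp
  qed
  have Lp: "L > 0" using m L by simp
  have "(L / m) ^ m * prob {w \<in> space M. real (card (?D w)) \<ge> L}
      = expectation (\<lambda>w. (L / m) ^ m * indicator {w \<in> space M. real (card (?D w)) \<ge> L} w)"
    using ev' by simp
  also have "\<dots> \<le> expectation (\<lambda>w. \<Sum>A\<in>?S. indicator (?E A) w)"
  proof (rule integral_mono)
    show "integrable M (\<lambda>w. (L / m) ^ m * indicator {w \<in> space M. real (card (?D w)) \<ge> L} w)"
      using ev' by (intro integrable_mult_right integrable_real_indicator) (auto simp: emeasure_eq_measure)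
    show "integrable M (\<lambda>w. \<Sum>A\<in>?S. indicator (?E A) w :: real)"
      using ev by (intro Bochner_Integration.integrable_sum integrable_real_indicator) (auto simp: emeasure_eq_measure)
    fix w assume w: "w \<in> space M"
    show "(L / m) ^ m * indicator {w \<in> space M. real (card (?D w)) \<ge> L} w \<le> (\<Sum>A\<in>?S. indicator (?E A) w)"
    proof (cases "real (card (?D w)) \<ge> L")
      case True
      then have "m \<le> card (?D w)" using L by linarith
      then have "(real (card (?D w)) / m) ^ m \<le> real (card (?D w) choose m)"
        by (rule binomial_ge_n_over_k_pow_k)
      moreover have "(L / m) ^ m \<le> (real (card (?D w)) / m) ^ m"
        using True Lp by (intro power_mono divide_right_mono) auto
      ultimately show ?thesis using choose[OF w] True w by simp
    next
      case False
      then show ?thesis by (auto intro!: sum_nonneg)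
    qed
  qed
  also have "\<dots> = (\<Sum>A\<in>?S. prob (?E A))"
    using ev by (subst Bochner_Integration.integral_sum) (auto simp: emeasure_eq_measure)
  also have "\<dots> \<le> (\<Sum>A\<in>?S. \<Prod>i<m. exp 1 * (2 * r)\<^sup>2 / (s * h * gap A i))"
    by (intro sum_mono prob_subset_hits_le[OF ab s h r]) auto
  also have "\<dots> \<le> ?F ^ m"
    using s h by (intro sum_subsets_prod_gap_le) auto
  finally have "(L / m) ^ m * prob {w \<in> space M. real (card (?D w)) \<ge> L} \<le> ?F ^ m" .
  then have "prob {w \<in> space M. real (card (?D w)) \<ge> L} \<le> ?F ^ m / (L / m) ^ m"
    using Lp m by (simp add: pos_le_divide_eq mult.commute)
  also have "\<dots> = (?F * m / L) ^ m" by (simp add: power_divide power_mult_distrib)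
  finally show ?le .
qed

end

section \<open>Dyadic chaining\<close>

text \<open>Each dyadic block contributes at most 1, so the logarithm of the number of times enters
  as a term linear in the level.\<close>

lemma sum_inverse_pow2_le: "(\<Sum>g=1..2 ^ q. 1 / real g) \<le> 1 + real q"
proof (induction q)
  case (Suc q)
  have "{1..(2::nat) ^ Suc q} = {1..2 ^ q} \<union> {2 ^ q <.. 2 ^ Suc q}" by auto
  then have "(\<Sum>g=1..2 ^ Suc q. 1 / real g) = (\<Sum>g=1..2 ^ q. 1 / real g) + (\<Sum>g\<in>{2 ^ q <.. 2 ^ Suc q}. 1 / real g)"
    by (simp only:) (rule sum.union_disjoint, auto)
  also have "(\<Sum>g\<in>{(2::nat) ^ q <.. 2 ^ Suc q}. 1 / real g) \<le> (\<Sum>g\<in>{(2::nat) ^ q <.. 2 ^ Suc q}. 1 / 2 ^ q)"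
  proof (rule sum_mono)
    fix g assume "g \<in> {(2::nat) ^ q <.. 2 ^ Suc q}"
    then have "real (2 ^ q) \<le> real g" by (subst of_nat_le_iff) auto
    then show "1 / real g \<le> 1 / 2 ^ q" by (intro divide_left_mono) (auto intro!: mult_pos_pos intro: less_le_trans[of 0 "2^q"])
  qed
  also have "\<dots> = 1" by simp
  finally show ?case using Suc by simp
qed simp

lemma summable_poly_over_pow2: "summable (\<lambda>n. (real n + c) ^ m * (1/2) ^ n)"
proof -
  \<comment> \<open>Any ratio strictly between 1/2 and 1 absorbs the polynomial.\<close>
  have "(\<lambda>n. (real n + c) ^ m * (1/2) ^ n) \<in> O(\<lambda>n. (3/4) ^ n)"
    by real_asymp
  then show ?thesis
    by (rule summable_comparison_test_bigo[rotated]) (simp add: summable_norm_cancel)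
qed

lemma nat_floor_double:
  fixes x :: real
  assumes "x \<ge> 0"
  shows "nat \<lfloor>2 * x\<rfloor> = 2 * nat \<lfloor>x\<rfloor> \<or> nat \<lfloor>2 * x\<rfloor> = Suc (2 * nat \<lfloor>x\<rfloor>)"
  using assms by linarith

text \<open>The numerator is kept as a natural number so that it can serve directly as a grid index
  in \<open>hits\<close>.\<close>

definition dyfloor :: "nat \<Rightarrow> real \<Rightarrow> real" where
  "dyfloor n x = real (nat \<lfloor>2 ^ n * x\<rfloor>) / 2 ^ n"

lemma dyfloor_bounds:
  assumes "x \<ge> 0"
  shows "0 \<le> dyfloor n x" "dyfloor n x \<le> x" "x < dyfloor n x + 1 / 2 ^ n"
proof -
  have "real (nat \<lfloor>2 ^ n * x\<rfloor>) \<le> 2 ^ n * x" "2 ^ n * x < real (nat \<lfloor>2 ^ n * x\<rfloor>) + 1"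
    using assms by (auto simp: of_nat_nat)
  then show "0 \<le> dyfloor n x" "dyfloor n x \<le> x" "x < dyfloor n x + 1 / 2 ^ n"
    by (auto simp: dyfloor_def field_simps)
qed

lemma dyfloor_tendsto:
  assumes "x \<ge> 0"
  shows "(\<lambda>n. dyfloor n x) \<longlonglongrightarrow> x"
proof (rule tendsto_sandwich)
  show "\<forall>\<^sub>F n in sequentially. x - 1 / 2 ^ n \<le> dyfloor n x"
    using dyfloor_bounds(3)[OF assms] by (intro always_eventually allI) (smt (verit))
  show "\<forall>\<^sub>F n in sequentially. dyfloor n x \<le> x"
    using dyfloor_bounds(2)[OF assms] by simp
  show "(\<lambda>n. x - 1 / 2 ^ n) \<longlonglongrightarrow> x" by real_asymp
qed simp

lemma nat_floor_pow2_less: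
  fixes x :: real
  assumes "0 \<le> x" "x < 2 ^ K"
  shows "nat \<lfloor>2 ^ n * x\<rfloor> < 2 ^ (K + n)"
proof -
  have "real (nat \<lfloor>2 ^ n * x\<rfloor>) \<le> 2 ^ n * x" using assms by (simp add: of_nat_nat)
  also have "\<dots> < 2 ^ n * 2 ^ K" using assms by simp
  also have "\<dots> = real (2 ^ (K + n))" by (simp add: power_add)
  finally show ?thesis by (simp only: of_nat_less_iff)
qed

text \<open>Passing from one level to the next moves each coordinate of the lower left corner by
  zero or one step of the finer grid. The costs form a geometric series, and continuity identifies
  the limit of the corners.\<close>

lemma dyadic_chaining:
  fixes f :: "real \<times> real \<Rightarrow> real"
  assumes cont: "continuous_on {p. fst p \<ge> 0 \<and> snd p \<ge> 0} f" and q: "0 < q" "q < 1"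
    and h1: "\<And>n i j. n \<ge> n0 \<Longrightarrow> i < 2 ^ (K + n) \<Longrightarrow> j < 2 ^ (K + n) \<Longrightarrow>
      \<bar>f (real (Suc i) / 2 ^ n, real j / 2 ^ n) - f (real i / 2 ^ n, real j / 2 ^ n)\<bar> \<le> q ^ n"
    and h2: "\<And>n i j. n \<ge> n0 \<Longrightarrow> i < 2 ^ (K + n) \<Longrightarrow> j < 2 ^ (K + n) \<Longrightarrow>
      \<bar>f (real i / 2 ^ n, real (Suc j) / 2 ^ n) - f (real i / 2 ^ n, real j / 2 ^ n)\<bar> \<le> q ^ n"
    and s: "0 \<le> s" "s < 2 ^ K" and t: "0 \<le> t" "t < 2 ^ K" and n: "n \<ge> n0"
  shows "\<bar>f (s, t) - f (dyfloor n s, dyfloor n t)\<bar> \<le> 2 / (1 - q) * q ^ n"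
proof -
  define g where "g k = f (dyfloor k s, dyfloor k t)" for k
  have step: "\<bar>g (Suc k) - g k\<bar> \<le> 2 * q ^ Suc k" if k: "k \<ge> n0" for k
  proof -
    define i j where "i = nat \<lfloor>2 ^ k * s\<rfloor>" and "j = nat \<lfloor>2 ^ k * t\<rfloor>"
    define i' j' where "i' = nat \<lfloor>2 ^ Suc k * s\<rfloor>" and "j' = nat \<lfloor>2 ^ Suc k * t\<rfloor>"
    define F where "F a b = f (real a / 2 ^ Suc k, real b / 2 ^ Suc k)" for a b :: nat
    have "i < 2 ^ (K + k)" "j < 2 ^ (K + k)"
      unfolding i_def j_def by (rule nat_floor_pow2_less[OF s], rule nat_floor_pow2_less[OF t])
    then have ij: "2 * i < 2 ^ (K + Suc k)" "2 * j < 2 ^ (K + Suc k)" by simp_all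
    have ij': "i' < 2 ^ (K + Suc k)" "j' < 2 ^ (K + Suc k)"
      unfolding i'_def j'_def by (rule nat_floor_pow2_less[OF s], rule nat_floor_pow2_less[OF t])
    have i': "i' = 2 * i \<or> i' = Suc (2 * i)"
      using nat_floor_double[of "2 ^ k * s"] s by (simp add: i'_def i_def mult.assoc)
    have j': "j' = 2 * j \<or> j' = Suc (2 * j)"
      using nat_floor_double[of "2 ^ k * t"] t by (simp add: j'_def j_def mult.assoc)
    \<comment> \<open>The coarse corner has indices \<open>2 * i\<close>, \<open>2 * j\<close> on
      the finer grid; the path moves in the first coordinate and then, from \<open>i'\<close>, in
      the second.\<close>
    have "\<bar>F i' (2 * j) - F (2 * i) (2 * j)\<bar> \<le> q ^ Suc k"
      using i' h1[of "Suc k" "2 * i" "2 * j"] ij k q unfolding F_def by auto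
    moreover have "\<bar>F i' j' - F i' (2 * j)\<bar> \<le> q ^ Suc k"
      using j' h2[of "Suc k" i' "2 * j"] ij ij' k q unfolding F_def by auto
    moreover have "g (Suc k) = F i' j'" by (simp add: g_def F_def dyfloor_def i'_def j'_def)
    moreover have "g k = F (2 * i) (2 * j)" by (simp add: g_def F_def dyfloor_def i_def j_def)
    ultimately show ?thesis by linarith
  qed
  \<comment> \<open>Keeping the subtracted term \<open>q ^ (n + k)\<close> lets the induction close
    by telescoping.\<close>
  have bound: "\<bar>g (n + k) - g n\<bar> \<le> 2 / (1 - q) * (q ^ n - q ^ (n + k))" for k
  proof (induction k)
    case (Suc k)
    have "\<bar>g (n + Suc k) - g n\<bar> \<le> 2 * q ^ Suc (n + k) + 2 / (1 - q) * (q ^ n - q ^ (n + k))"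
      using step[of "n + k"] Suc n by simp
    also have "\<dots> \<le> 2 * q ^ (n + k) + 2 / (1 - q) * (q ^ n - q ^ (n + k))"
      using q by (simp add: mult_left_le_one_le)
    also have "2 * q ^ (n + k) = 2 / (1 - q) * (q ^ (n + k) - q ^ (n + Suc k))"
      using q by (simp add: field_simps)
    finally show ?case by (simp add: algebra_simps)
  qed simp
  have "(\<lambda>k. (dyfloor k s, dyfloor k t)) \<longlonglongrightarrow> (s, t)"
    using s t by (intro tendsto_Pair dyfloor_tendsto)
  then have "g \<longlonglongrightarrow> f (s, t)"
    unfolding g_def using s t dyfloor_bounds(1)
    by (intro continuous_on_tendsto_compose[OF cont]) auto
  then have "(\<lambda>k. g (k + n)) \<longlonglongrightarrow> f (s, t)" by (rule LIMSEQ_ignore_initial_segment)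
  then have "(\<lambda>k. \<bar>g (k + n) - g n\<bar>) \<longlonglongrightarrow> \<bar>f (s, t) - g n\<bar>"
    by (intro tendsto_intros)
  moreover have "\<bar>g (k + n) - g n\<bar> \<le> 2 / (1 - q) * q ^ n" for k
  proof -
    have "2 / (1 - q) * (q ^ n - q ^ (n + k)) \<le> 2 / (1 - q) * q ^ n"
      using q by (intro mult_left_mono) auto
    then show ?thesis using bound[of k] by (simp add: add.commute)
  qed
  ultimately show ?thesis unfolding g_def by (intro LIMSEQ_le_const2) auto
qed


section \<open>Almost sure bounds\<close>

text \<open>A union bound inside each level precedes Borel-Cantelli, so the number of events may
  grow with \<open>n\<close>. The bound \<open>p n\<close> is asked for only eventually, because the
  hit estimate needs a threshold exceeding the moment order.\<close>

lemma (in prob_space) borel_cantelli_finite_families: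
  assumes fin: "\<And>n. finite (I n)" and ev: "\<And>n i. i \<in> I n \<Longrightarrow> A n i \<in> events"
    and p: "\<forall>\<^sub>F n in sequentially. \<forall>i\<in>I n. prob (A n i) \<le> p n"
    and sum: "summable (\<lambda>n. real (card (I n)) * p n)"
  shows "AE w in M. \<forall>\<^sub>F n in sequentially. \<forall>i\<in>I n. w \<notin> A n i"
proof -
  let ?U = "\<lambda>n. \<Union>i\<in>I n. A n i"
  have U: "?U n \<in> events" for n using fin ev by (intro sets.finite_UN) auto
  have "\<forall>\<^sub>F n in sequentially. norm (prob (?U n)) \<le> real (card (I n)) * p n"
    using p
  proof eventually_elim
    case (elim n)
    have "prob (?U n) \<le> (\<Sum>i\<in>I n. prob (A n i))"
      using fin ev by (intro finite_measure_subadditive_finite) auto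
    also have "\<dots> \<le> (\<Sum>i\<in>I n. p n)" using elim by (intro sum_mono) auto
    finally show ?case by simp
  qed
  then have "summable (\<lambda>n. prob (?U n))" by (rule summable_comparison_test_ev[OF _ sum])
  then have "AE w in M. \<forall>\<^sub>F n in sequentially. w \<in> space M - ?U n"
    by (intro borel_cantelli_AE1 U) (auto simp: emeasure_eq_measure)
  then show ?thesis by eventually_elim (auto elim: eventually_mono)
qed

lemma exists_power_le:
  fixes x e :: real
  assumes "0 < x" "x < 1" "0 < e"
  obtains k where "k > 0" "x ^ k \<le> e"
proof -
  obtain k where "x ^ k < e" using real_arch_pow_inv[OF assms(3,2)] by blast
  moreover have "x ^ Suc k \<le> x ^ k" using assms by (simp add: mult_left_le_one_le)
  ultimately show ?thesis using that[of "Suc k"] by simp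
qed

section \<open>Gaussian tails, the uniform modulus and uniform hit counts\<close>

context sheet
begin

text \<open>Markov's inequality for the moment of order 2k. In the application V / x^2 decays only
  like a small negative power of 2^n, which a large \<open>k\<close> amplifies.\<close>

lemma gspan_tail:
  assumes Y: "Y \<in> gspan" and V: "expectation (\<lambda>w. Y w * Y w) \<le> V" and x: "x > 0"
  shows "prob {w \<in> space M. \<bar>Y w\<bar> > x} \<le> fact (2 * k) / (2 ^ k * fact k) * (V / x\<^sup>2) ^ k"
proof -
  have [measurable]: "Y \<in> borel_measurable M" using gspan_measurable[OF Y] .
  have int: "integrable M (\<lambda>w. Y w ^ (2 * k))"
    using centered_normal_moment_integrable gspan_normal[OF Y] by blast
  have "prob {w \<in> space M. \<bar>Y w\<bar> > x} \<le> prob {w \<in> space M. Y w ^ (2 * k) \<ge> x ^ (2 * k)}"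
  proof (rule finite_measure_mono)
    show "{w \<in> space M. \<bar>Y w\<bar> > x} \<subseteq> {w \<in> space M. Y w ^ (2 * k) \<ge> x ^ (2 * k)}"
    proof safe
      fix w assume "\<bar>Y w\<bar> > x"
      then have "x ^ (2 * k) \<le> \<bar>Y w\<bar> ^ (2 * k)" using x by (intro power_mono) auto
      then show "x ^ (2 * k) \<le> Y w ^ (2 * k)" by (simp add: power_even_abs)
    qed
  qed measurable
  also have "\<dots> \<le> expectation (\<lambda>w. Y w ^ (2 * k)) / x ^ (2 * k)"
    using x by (intro integral_Markov_inequality_measure[OF int sets.empty_sets]) auto
  also have "\<dots> = fact (2 * k) / (2 ^ k * fact k) * (expectation (\<lambda>w. Y w * Y w) ^ k / x ^ (2 * k))"
    using centered_normal_moment_even[OF gspan_normal[OF Y], of k] by (simp add: power2_eq_square)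
  also have "\<dots> \<le> fact (2 * k) / (2 ^ k * fact k) * (V ^ k / x ^ (2 * k))"
    using V x by (intro mult_left_mono divide_right_mono power_mono) auto
  finally show ?thesis by (simp add: power_divide power_mult)
qed

lemma increment_variance:
  assumes "0 \<le> s" "s \<le> u" "0 \<le> t" "t \<le> v"
  shows "expectation (\<lambda>w. (B w (u, v) $ c - B w (s, t) $ c) * (B w (u, v) $ c - B w (s, t) $ c)) = u * v - s * t"
  using assms by (subst gspan_cov_diff) (auto intro!: gspan_coord simp: cov min_def)

text \<open>
  The base \<open>\<beta>\<close> is a number slightly below 1 and \<open>q = 1 / (sqrt 2 * \<beta>)\<close>, that is
  \<open>\<beta> = 2 powr (- \<eta>)\<close> and \<open>q = 2 powr (\<eta> - 1/2)\<close> for a small \<open>\<eta> > 0\<close>.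
\<close>

lemma dyadic_increments_AE:
  assumes q: "q > 0" and \<beta>: "0 < \<beta>" "\<beta> < 1" and q\<beta>: "2 * q\<^sup>2 * \<beta>\<^sup>2 = 1"
  shows "AE w in M. \<forall>\<^sub>F n in sequentially. \<forall>i<2 ^ (K + n). \<forall>j<2 ^ (K + n).
     \<bar>B w (real (Suc i) / 2 ^ n, real j / 2 ^ n) $ c - B w (real i / 2 ^ n, real j / 2 ^ n) $ c\<bar> \<le> q ^ n \<and>
     \<bar>B w (real i / 2 ^ n, real (Suc j) / 2 ^ n) $ c - B w (real i / 2 ^ n, real j / 2 ^ n) $ c\<bar> \<le> q ^ n"
proof -
  \<comment> \<open>This \<open>k\<close> bounds each increment's failure probability by a multiple
    of (1/16)^n, against 2 * 4^(K + n) increments.\<close>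
  obtain k where k: "k > 0" "\<beta> ^ k \<le> 1 / 4" using exists_power_le[OF \<beta>, of "1/4"] by auto
  \<comment> \<open>The Boolean \<open>v\<close> selects the direction: a step in the first
    parameter if true, in the second if false.\<close>
  define Y where "Y n = (\<lambda>(i, j, v) w. B w (if v then (real (Suc i) / 2 ^ n, real j / 2 ^ n) else (real i / 2 ^ n, real (Suc j) / 2 ^ n)) $ c
    - B w (real i / 2 ^ n, real j / 2 ^ n) $ c)" for n
  define I :: "nat \<Rightarrow> (nat \<times> nat \<times> bool) set" where "I n = {..<2 ^ (K + n)} \<times> {..<2 ^ (K + n)} \<times> UNIV" for n
  define C :: real where "C = fact (2 * k) / (2 ^ k * fact k) * (2 ^ K) ^ k"
  have C: "C \<ge> 0" by (simp add: C_def)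
  have Y: "Y n x \<in> gspan" for n x
    unfolding Y_def by (cases x) (auto intro!: gspan_diff gspan_coord)
  have var: "expectation (\<lambda>w. Y n x w * Y n x w) \<le> 2 ^ K * (1/2) ^ n" if x: "x \<in> I n" for n x
  proof -
    obtain i j v where ijv: "x = (i, j, v)" by (cases x)
    have "i < 2 ^ (K + n)" "j < 2 ^ (K + n)" using x by (auto simp: I_def ijv)
    then have "real i \<le> real (2 ^ (K + n))" "real j \<le> real (2 ^ (K + n))"
      by (auto simp only: of_nat_le_iff)
    then have le: "real i / 2 ^ n \<le> 2 ^ K" "real j / 2 ^ n \<le> 2 ^ K"
      by (auto simp: power_add field_simps)
    have "expectation (\<lambda>w. Y n x w * Y n x w) = (if v then real j / 2 ^ n else real i / 2 ^ n) * (1/2) ^ n"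
      unfolding Y_def ijv prod.case
      using increment_variance[of "real i / 2 ^ n" "real (Suc i) / 2 ^ n" "real j / 2 ^ n" "real j / 2 ^ n" c]
        increment_variance[of "real i / 2 ^ n" "real i / 2 ^ n" "real j / 2 ^ n" "real (Suc j) / 2 ^ n" c]
      by (cases v) (simp_all add: divide_right_mono field_simps)
    also have "\<dots> \<le> 2 ^ K * (1/2) ^ n" using le by (intro mult_right_mono) auto
    finally show ?thesis .
  qed
  have ratio: "(1/2) ^ n / (q ^ n)\<^sup>2 = (\<beta> ^ n)\<^sup>2" for n
  proof -
    have "\<beta>\<^sup>2 = (1/2) / q\<^sup>2" using q\<beta> q by (simp add: field_simps)
    then show ?thesis by (metis power_divide power_mult mult.commute)
  qed
  have pr: "prob {w \<in> space M. \<bar>Y n x w\<bar> > q ^ n} \<le> C * (1/16) ^ n" if x: "x \<in> I n" for n x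
  proof -
    have "prob {w \<in> space M. \<bar>Y n x w\<bar> > q ^ n} \<le> fact (2 * k) / (2 ^ k * fact k) * (2 ^ K * (1/2) ^ n / (q ^ n)\<^sup>2) ^ k"
      using q by (intro gspan_tail[OF Y var[OF x]]) simp
    also have "2 ^ K * (1/2) ^ n / (q ^ n)\<^sup>2 = 2 ^ K * (\<beta> ^ n)\<^sup>2"
      unfolding times_divide_eq_right[symmetric] ratio ..
    also have "(2 ^ K * (\<beta> ^ n)\<^sup>2) ^ k = (2 ^ K) ^ k * ((\<beta> ^ k)\<^sup>2) ^ n"
      by (simp add: power_mult_distrib power_mult[symmetric] mult_ac)
    also have "fact (2 * k) / (2 ^ k * fact k) * \<dots> = C * ((\<beta> ^ k)\<^sup>2) ^ n" by (simp add: C_def)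
    also have "\<dots> \<le> C * ((1/4)\<^sup>2) ^ n"
      using k \<beta> C by (intro mult_left_mono power_mono) auto
    finally show ?thesis by (simp add: power2_eq_square)
  qed
  have "AE w in M. \<forall>\<^sub>F n in sequentially. \<forall>x\<in>I n. w \<notin> {w \<in> space M. \<bar>Y n x w\<bar> > q ^ n}"
  proof (rule borel_cantelli_finite_families)
    show "finite (I n)" for n by (simp add: I_def)
    show "{w \<in> space M. \<bar>Y n x w\<bar> > q ^ n} \<in> events" for n x
    proof -
      have [measurable]: "Y n x \<in> borel_measurable M" by (rule gspan_measurable[OF Y])
      show ?thesis by measurable
    qed
    show "\<forall>\<^sub>F n in sequentially. \<forall>x\<in>I n. prob {w \<in> space M. \<bar>Y n x w\<bar> > q ^ n} \<le> C * (1/16) ^ n"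
      using pr by (intro always_eventually allI ballI) blast
    have eq: "real (card (I n)) * (C * (1/16) ^ n) = 2 * 4 ^ K * C * (1/4) ^ n" for n
    proof -
      have "(4::real) ^ x = 2 ^ x * 2 ^ x" for x by (simp add: power_mult_distrib[symmetric])
      then have "real (card (I n)) = 2 * 4 ^ K * 4 ^ n"
        by (simp add: I_def card_cartesian_product power_add mult_ac)
      moreover have "(4::real) ^ n * (1/16) ^ n = (1/4) ^ n" by (simp add: power_mult_distrib[symmetric])
      ultimately show ?thesis by (simp add: mult_ac)
    qed
    show "summable (\<lambda>n. real (card (I n)) * (C * (1/16) ^ n))"
      unfolding eq by (intro summable_mult summable_geometric) simp
  qed
  with AE_space show ?thesis
  proof eventually_elim
    case (elim w)
    from elim(2) show ?case
    proof eventually_elim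
      case (elim n)
      show ?case
      proof (intro allI impI conjI)
        fix i j :: nat assume ij: "i < 2 ^ (K + n)" "j < 2 ^ (K + n)"
        then have mem: "(i, j, v) \<in> I n" for v by (simp add: I_def)
        have *: "\<bar>Y n (i, j, v) w\<bar> \<le> q ^ n" for v
          using bspec[OF elim mem] \<open>w \<in> space M\<close> by (simp add: not_less)
        show "\<bar>B w (real (Suc i) / 2 ^ n, real j / 2 ^ n) $ c - B w (real i / 2 ^ n, real j / 2 ^ n) $ c\<bar> \<le> q ^ n"
          using *[of True] by (simp add: Y_def)
        show "\<bar>B w (real i / 2 ^ n, real (Suc j) / 2 ^ n) $ c - B w (real i / 2 ^ n, real j / 2 ^ n) $ c\<bar> \<le> q ^ n"
          using *[of False] by (simp add: Y_def)
      qed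
    qed
  qed
qed

text \<open>Uniformity over all (s, t) is deterministic: probability enters only through countably
  many dyadic increments, and chaining is applied path by path.\<close>

lemma modulus_AE:
  assumes q: "0 < q" "q < 1" and \<beta>: "0 < \<beta>" "\<beta> < 1" and q\<beta>: "2 * q\<^sup>2 * \<beta>\<^sup>2 = 1"
  shows "AE w in M. \<forall>\<^sub>F n in sequentially. \<forall>s t. 0 \<le> s \<and> s < 2 ^ K \<and> 0 \<le> t \<and> t < 2 ^ K \<longrightarrow>
     \<bar>B w (s, t) $ c - B w (dyfloor n s, dyfloor n t) $ c\<bar> \<le> 2 / (1 - q) * q ^ n"
  using dyadic_increments_AE[OF q(1) \<beta> q\<beta>, of K c] AE_space
proof eventually_elim
  case (elim w)
  have cont: "continuous_on {p. fst p \<ge> 0 \<and> snd p \<ge> 0} (\<lambda>p. B w p $ c)"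
    using sheet elim(2) unfolding brownian_sheet_def by (auto intro!: continuous_on_component)
  from elim(1) obtain n0 where n0: "\<And>n i j. n \<ge> n0 \<Longrightarrow> i < 2 ^ (K + n) \<Longrightarrow> j < 2 ^ (K + n) \<Longrightarrow>
     \<bar>B w (real (Suc i) / 2 ^ n, real j / 2 ^ n) $ c - B w (real i / 2 ^ n, real j / 2 ^ n) $ c\<bar> \<le> q ^ n \<and>
     \<bar>B w (real i / 2 ^ n, real (Suc j) / 2 ^ n) $ c - B w (real i / 2 ^ n, real j / 2 ^ n) $ c\<bar> \<le> q ^ n"
    unfolding eventually_sequentially by blast
  show ?case
    unfolding eventually_sequentially
  proof (intro exI[of _ n0] allI impI)
    fix n and s t :: real assume n: "n0 \<le> n" and st: "0 \<le> s \<and> s < 2 ^ K \<and> 0 \<le> t \<and> t < 2 ^ K"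
    show "\<bar>B w (s, t) $ c - B w (dyfloor n s, dyfloor n t) $ c\<bar> \<le> 2 / (1 - q) * q ^ n"
      using dyadic_chaining[OF cont q, of n0 K s t n] n0 n st by blast
  qed
qed

text \<open>The gap sum has order n \<beta>^(-2n) and the threshold is \<beta>^(-3n), so their
  quotient is of order n \<beta>^n. Its m-th power must beat the number of dyadic slices, at most
  2^(K + n).\<close>

lemma card_hits_AE:
  assumes ab: "a \<noteq> b" and C: "C > 0" and q: "q > 0" and \<beta>: "0 < \<beta>" "\<beta> < 1" and q\<beta>: "2 * q\<^sup>2 * \<beta>\<^sup>2 = 1"
  shows "AE w in M. \<forall>\<^sub>F n in sequentially. \<forall>i. 2 ^ n \<le> 2 ^ K * i \<and> i < 2 ^ (K + n) \<longrightarrow>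
    real (card (hits a b (real i / 2 ^ n) (1 / 2 ^ n) (C * q ^ n) (2 ^ (K + n)) w)) < (1 / \<beta> ^ 3) ^ n"
proof -
  obtain m where m: "m > 0" "\<beta> ^ m \<le> 1 / 4" using exists_power_le[OF \<beta>, of "1/4"] by auto
  define I where "I n = {i :: nat. 2 ^ n \<le> 2 ^ K * i \<and> i < 2 ^ (K + n)}" for n
  define L where "L n = (1 / \<beta> ^ 3) ^ n" for n
  define D where "D n i w = hits a b (real i / 2 ^ n) (1 / 2 ^ n) (C * q ^ n) (2 ^ (K + n)) w" for n i w
  define c where "c = exp 1 * (2 * C)\<^sup>2 * 2 ^ K * m"
  have c: "c \<ge> 0" by (simp add: c_def)
  have \<beta>3: "1 / \<beta> ^ 3 > 1" using \<beta> power_strict_mono[of \<beta> 1 3] by (simp add: field_simps)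
  have L1: "L n \<ge> 1" for n unfolding L_def using \<beta>3 by (intro one_le_power) simp
  have ipos: "i > 0" if "i \<in> I n" for i n
    using that by (cases i) (auto simp: I_def)
  have finI: "finite (I n)" for n unfolding I_def by simp
  have cardI: "real (card (I n)) \<le> 2 ^ K * 2 ^ n" for n
  proof -
    have "card (I n) \<le> card {..<(2::nat) ^ (K + n)}" unfolding I_def by (intro card_mono) auto
    then have "real (card (I n)) \<le> real (2 ^ (K + n))" by (simp only: card_lessThan of_nat_le_iff)
    then show ?thesis by (simp add: power_add)
  qed
  have F: "(\<Sum>g=1..2 ^ (K + n). exp 1 * (2 * (C * q ^ n))\<^sup>2 / (real i / 2 ^ n * (1 / 2 ^ n) * real g)) * m / L n
      \<le> c * (real n + (1 + real K)) * \<beta> ^ n" if i: "i \<in> I n" for n i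
  proof -
    \<comment> \<open>Membership in \<open>I n\<close> says that the slice i / 2^n is at least
      2^(-K), which bounds the factor 1/s.\<close>
    have "real (2 ^ n) \<le> real (2 ^ K * i)" using i by (simp only: of_nat_le_iff I_def mem_Collect_eq)
    then have i': "2 ^ n / real i \<le> 2 ^ K" using ipos[OF i] by (simp add: field_simps)
    have "(q ^ n)\<^sup>2 * 2 ^ n = (2 * q\<^sup>2) ^ n" by (simp add: power_mult_distrib power_mult[symmetric] mult.commute)
    also have "2 * q\<^sup>2 = 1 / \<beta>\<^sup>2" using q\<beta> \<beta> by (simp add: field_simps)
    finally have q2: "(q ^ n)\<^sup>2 * 2 ^ n = (1 / \<beta>\<^sup>2) ^ n" .
    have "(\<Sum>g=1..2 ^ (K + n). exp 1 * (2 * (C * q ^ n))\<^sup>2 / (real i / 2 ^ n * (1 / 2 ^ n) * real g))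
        = exp 1 * (2 * C)\<^sup>2 * ((q ^ n)\<^sup>2 * 2 ^ n) * (2 ^ n / real i) * (\<Sum>g=1..2 ^ (K + n). 1 / real g)"
      unfolding sum_distrib_left using ipos[OF i] by (intro sum.cong refl) (simp add: power_mult_distrib field_simps)
    also have "\<dots> \<le> exp 1 * (2 * C)\<^sup>2 * ((q ^ n)\<^sup>2 * 2 ^ n) * 2 ^ K * (1 + real (K + n))"
      using i' sum_inverse_pow2_le[of "K + n"] q by (intro mult_mono mult_left_mono) (auto intro!: sum_nonneg)
    also have "\<dots> = exp 1 * (2 * C)\<^sup>2 * 2 ^ K * (1 + real (K + n)) * (1 / \<beta>\<^sup>2) ^ n"
      by (simp add: q2)
    finally have "(\<Sum>g=1..2 ^ (K + n). exp 1 * (2 * (C * q ^ n))\<^sup>2 / (real i / 2 ^ n * (1 / 2 ^ n) * real g)) * m / L n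
      \<le> exp 1 * (2 * C)\<^sup>2 * 2 ^ K * (1 + real (K + n)) * (1 / \<beta>\<^sup>2) ^ n * m / L n"
      using L1[of n] by (intro divide_right_mono mult_right_mono) auto
    also have "\<dots> = c * (real n + (1 + real K)) * ((1 / \<beta>\<^sup>2) ^ n / L n)"
      by (simp add: c_def mult_ac add_ac)
    also have "(1 / \<beta>\<^sup>2) ^ n / L n = \<beta> ^ n"
    proof -
      have "(1 / \<beta>\<^sup>2) / (1 / \<beta> ^ 3) = \<beta>" using \<beta> by (simp add: power2_eq_square power3_eq_cube)
      then show ?thesis unfolding L_def power_divide[symmetric] by simp
    qed
    finally show ?thesis .
  qed
  have "AE w in M. \<forall>\<^sub>F n in sequentially. \<forall>i\<in>I n. w \<notin> {w \<in> space M. real (card (D n i w)) \<ge> L n}"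
  proof (rule borel_cantelli_finite_families[OF finI])
    show "{w \<in> space M. real (card (D n i w)) \<ge> L n} \<in> events" if "i \<in> I n" for n i
      \<comment> \<open>Measurability is wanted at every level, also where \<open>L n < m\<close>;
        the instance of order 1 asks only for \<open>L n \<ge> 1\<close>.\<close>
      unfolding D_def using ipos[OF that] C q L1[of n] by (intro prob_card_hits_ge(1)[OF ab, where m=1]) auto
    have "filterlim (\<lambda>n. x ^ n) at_top sequentially" if "x > 1" for x :: real
      using that by real_asymp
    from this[OF \<beta>3] have "filterlim L at_top sequentially"
      unfolding L_def .
    then have "\<forall>\<^sub>F n in sequentially. L n \<ge> real m" by (simp add: filterlim_at_top)
    then show "\<forall>\<^sub>F n in sequentially. \<forall>i\<in>I n. prob {w \<in> space M. real (card (D n i w)) \<ge> L n}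
        \<le> c ^ m * ((real n + (1 + real K)) ^ m * (1/4) ^ n)"
    proof eventually_elim
      case (elim n)
      show ?case
      proof
        fix i assume i: "i \<in> I n"
        have "prob {w \<in> space M. real (card (D n i w)) \<ge> L n}
          \<le> ((\<Sum>g=1..2 ^ (K + n). exp 1 * (2 * (C * q ^ n))\<^sup>2 / (real i / 2 ^ n * (1 / 2 ^ n) * real g)) * m / L n) ^ m"
          unfolding D_def using ipos[OF i] C q m elim by (intro prob_card_hits_ge(2)[OF ab]) auto
        also have "\<dots> \<le> (c * (real n + (1 + real K)) * \<beta> ^ n) ^ m"
          using L1[of n] by (intro power_mono F i) (auto intro!: divide_nonneg_nonneg mult_nonneg_nonneg sum_nonneg)
        also have "\<dots> = c ^ m * ((real n + (1 + real K)) ^ m * (\<beta> ^ m) ^ n)"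
          by (simp add: power_mult_distrib power_mult[symmetric] mult_ac)
        also have "\<dots> \<le> c ^ m * ((real n + (1 + real K)) ^ m * (1/4) ^ n)"
          using c m \<beta> by (intro mult_left_mono power_mono) auto
        finally show "prob {w \<in> space M. real (card (D n i w)) \<ge> L n} \<le> \<dots>" .
      qed
    qed
    have "summable (\<lambda>n. 2 ^ K * c ^ m * ((real n + (1 + real K)) ^ m * (1/2) ^ n))"
      by (intro summable_mult summable_poly_over_pow2)
    then show "summable (\<lambda>n. real (card (I n)) * (c ^ m * ((real n + (1 + real K)) ^ m * (1/4) ^ n)))"
    proof (rule summable_comparison_test_ev[rotated], intro always_eventually allI)
      fix n
      have "real (card (I n)) * (c ^ m * ((real n + (1 + real K)) ^ m * (1/4) ^ n))
        \<le> 2 ^ K * 2 ^ n * (c ^ m * ((real n + (1 + real K)) ^ m * (1/4) ^ n))"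
        using c by (intro mult_right_mono cardI) auto
      also have "\<dots> = 2 ^ K * c ^ m * ((real n + (1 + real K)) ^ m * (2 ^ n * (1/4) ^ n))" by (simp add: mult_ac)
      also have "(2::real) ^ n * (1/4) ^ n = (1/2) ^ n" by (simp add: power_mult_distrib[symmetric])
      finally show "norm (real (card (I n)) * (c ^ m * ((real n + (1 + real K)) ^ m * (1/4) ^ n)))
        \<le> 2 ^ K * c ^ m * ((real n + (1 + real K)) ^ m * (1/2) ^ n)"
        using c by simp
    qed
  qed
  with AE_space show ?thesis
  proof eventually_elim
    case (elim w)
    from elim(2) show ?case
      by eventually_elim (use \<open>w \<in> space M\<close> in \<open>auto simp: I_def D_def L_def not_le\<close>)
  qed
qed

end


section \<open>Covers of the zeros in a bounded window\<close>

lemma nat_floor_pow2_ge: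
  fixes x :: real
  assumes "1 / 2 ^ K \<le> x" "K \<le> n"
  shows "2 ^ n \<le> 2 ^ K * nat \<lfloor>2 ^ n * x\<rfloor>"
proof -
  \<comment> \<open>The point 2^(-K) lies on the grid of every level n \<ge> K, so rounding down
    cannot cross it.\<close>
  have "(2::real) ^ n = 2 ^ (n - K) * 2 ^ K" using assms(2) by (simp flip: power_add)
  then have "real_of_int (2 ^ (n - K)) = 2 ^ n * (1 / 2 ^ K)" by simp
  also have "\<dots> \<le> 2 ^ n * x" using assms(1) by (intro mult_left_mono) auto
  finally have "2 ^ (n - K) \<le> \<lfloor>2 ^ n * x\<rfloor>" by (simp only: le_floor_iff)
  then have "nat (2 ^ (n - K)) \<le> nat \<lfloor>2 ^ n * x\<rfloor>" by (rule nat_mono)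
  then have "2 ^ K * 2 ^ (n - K) \<le> 2 ^ K * nat \<lfloor>2 ^ n * x\<rfloor>" by (simp add: nat_power_eq)
  then show ?thesis using assms(2) by (simp flip: power_add)
qed

text \<open>A zero at (s, t) makes the grid index of t a hit on the dyadic slice just below s. Hence
  all slices in one dyadic column share one hit set, and control of finitely many columns per level
  covers every \<open>s\<close>.\<close>

lemma (in sheet) zeros_hausdorff_null_AE:
  fixes a b :: 'd
  assumes ab: "a \<noteq> b" and \<alpha>: "0 < \<alpha>" "\<alpha> \<le> 1"
  shows "AE w in M. \<forall>s. hausdorff_measure \<alpha> ({p. B w p = 0} \<inter> ({s} \<times> UNIV) \<inter>
      ({1 / 2 ^ K..<2 ^ K} \<times> {1 / 2 ^ K..<2 ^ K})) = 0"
proof -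
  define \<beta> :: real where "\<beta> = 2 powr (- \<alpha> / 4)"
  define q where "q = 1 / (sqrt 2 * \<beta>)"
  define C where "C = 2 / (1 - q)"
  have \<beta>: "0 < \<beta>" "\<beta> < 1" using \<alpha> powr_less_mono[of "- \<alpha> / 4" 0 2] by (auto simp: \<beta>_def)
  \<comment> \<open>Here \<open>\<alpha> \<le> 1\<close> enters: \<beta> stays above 2^(-1/2), so
    that \<open>q < 1\<close> and the chaining series converges.\<close>
  have "2 powr (- (1/2)) < \<beta>" unfolding \<beta>_def using \<alpha> by (intro powr_less_mono) auto
  then have "1 < sqrt 2 * \<beta>" by (simp add: powr_minus powr_half_sqrt field_simps)
  then have q: "0 < q" "q < 1" using \<beta> by (auto simp: q_def field_simps)
  have q\<beta>: "2 * q\<^sup>2 * \<beta>\<^sup>2 = 1" using \<beta> by (simp add: q_def power_divide power_mult_distrib)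
  have C: "C > 0" using q by (simp add: C_def)
  have hpow: "(1 / 2 ^ n) powr \<alpha> = (\<beta> ^ 4) ^ n" for n
  proof -
    have "(1 / 2 ^ n) powr \<alpha> = 2 powr (real n * (- \<alpha>))"
      by (simp add: powr_realpow[symmetric] powr_minus_divide[symmetric] powr_powr)
    also have "\<dots> = \<beta> powr (real (4 * n))" by (simp add: \<beta>_def powr_powr mult.commute)
    also have "\<dots> = \<beta> ^ (4 * n)" using \<beta> by (subst powr_realpow) auto
    finally show ?thesis by (simp add: power_mult)
  qed
  show ?thesis
    using modulus_AE[OF q \<beta> q\<beta>, of K a] modulus_AE[OF q \<beta> q\<beta>, of K b]
      card_hits_AE[OF ab C q(1) \<beta> q\<beta>, of K]
  proof eventually_elim
    case (elim w)
    show ?case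
    proof
      fix s
      let ?A = "{p. B w p = 0} \<inter> ({s} \<times> UNIV) \<inter> ({1 / 2 ^ K..<2 ^ K} \<times> {1 / 2 ^ K..<2 ^ K})"
      show "hausdorff_measure \<alpha> ?A = 0"
      proof (rule hausdorff_measure_eq_0_finite_covers[OF \<alpha>(1)])
        fix \<delta> \<epsilon> :: real assume d: "\<delta> > 0" and e: "\<epsilon> > 0"
        show "\<exists>(I :: nat set) U h. finite I \<and> ?A \<subseteq> (\<Union>i\<in>I. U i) \<and> h \<le> \<delta> \<and>
            (\<forall>i\<in>I. bounded (U i) \<and> diameter (U i) \<le> h) \<and> card I * h powr \<alpha> \<le> \<epsilon>"
        proof (cases "s \<in> {1 / 2 ^ K..<2 ^ K}")
          case False
          then have "?A = {}" by auto
          then show ?thesis using d e by (intro exI[of _ "{}"] exI[of _ 0]) auto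
        next
          case s: True
          have "(\<lambda>n. (1/2 :: real) ^ n) \<longlonglongrightarrow> 0" by real_asymp
          then have d': "\<forall>\<^sub>F n in sequentially. (1/2) ^ n < \<delta>" using d by (simp add: order_tendstoD)
          have "(\<lambda>n. \<beta> ^ n) \<longlonglongrightarrow> 0" using \<beta> by (intro LIMSEQ_realpow_zero) auto
          then have e': "\<forall>\<^sub>F n in sequentially. \<beta> ^ n < \<epsilon>" using e by (simp add: order_tendstoD)
          \<comment> \<open>A single level at which all the eventual statements hold yields the
            required cover.\<close>
          from eventually_happens[OF eventually_conj[OF eventually_ge_at_top[of K] eventually_conj[OF d' eventually_conj[OF e' eventually_conj[OF elim(1) eventually_conj[OF elim(2) elim(3)]]]]]]
          obtain n where n: "K \<le> n" "(1/2) ^ n < \<delta>" "\<beta> ^ n < \<epsilon>"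
            and ma: "\<And>s t. 0 \<le> s \<and> s < 2 ^ K \<and> 0 \<le> t \<and> t < 2 ^ K \<Longrightarrow>
              \<bar>B w (s, t) $ a - B w (dyfloor n s, dyfloor n t) $ a\<bar> \<le> C * q ^ n"
            and mb: "\<And>s t. 0 \<le> s \<and> s < 2 ^ K \<and> 0 \<le> t \<and> t < 2 ^ K \<Longrightarrow>
              \<bar>B w (s, t) $ b - B w (dyfloor n s, dyfloor n t) $ b\<bar> \<le> C * q ^ n"
            and hc: "\<And>i. 2 ^ n \<le> 2 ^ K * i \<and> i < 2 ^ (K + n) \<Longrightarrow>
              real (card (hits a b (real i / 2 ^ n) (1 / 2 ^ n) (C * q ^ n) (2 ^ (K + n)) w)) < (1 / \<beta> ^ 3) ^ n"
            unfolding C_def by auto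
          define i where "i = nat \<lfloor>2 ^ n * s\<rfloor>"
          define I where "I = hits a b (real i / 2 ^ n) (1 / 2 ^ n) (C * q ^ n) (2 ^ (K + n)) w"
          \<comment> \<open>The segments lie on the actual slice \<open>s\<close>, although the hits
            are counted on the dyadic slice i / 2^n.\<close>
          define U where "U j = {s} \<times> {real j / 2 ^ n .. real (Suc j) / 2 ^ n}" for j
          have pos: "x \<ge> 0" if "x \<in> {1 / 2 ^ K..<2 ^ K}" for x :: real
            using that by (auto intro: order_trans[rotated])
          have "2 ^ n \<le> 2 ^ K * i" unfolding i_def using s n by (intro nat_floor_pow2_ge) auto
          moreover have "i < 2 ^ (K + n)" unfolding i_def using s pos[OF s] by (intro nat_floor_pow2_less) auto
          ultimately have cardI: "real (card I) < (1 / \<beta> ^ 3) ^ n" unfolding I_def by (intro hc) simp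
          have fin: "finite I" unfolding I_def hits_def by simp
          moreover have "?A \<subseteq> (\<Union>j\<in>I. U j)"
          proof
            fix p assume p: "p \<in> ?A"
            then obtain t where t: "p = (s, t)" "t \<in> {1 / 2 ^ K..<2 ^ K}" "B w (s, t) = 0" by auto
            define j where "j = nat \<lfloor>2 ^ n * t\<rfloor>"
            have t0: "t \<ge> 0" using pos[OF t(2)] .
            have "2 ^ n \<le> 2 ^ K * j" unfolding j_def using t n by (intro nat_floor_pow2_ge) auto
            then have j1: "j \<ge> 1" by (cases j) auto
            have j2: "j < 2 ^ (K + n)" unfolding j_def using t t0 by (intro nat_floor_pow2_less) auto
            have st: "0 \<le> s \<and> s < 2 ^ K \<and> 0 \<le> t \<and> t < 2 ^ K" using s t t0 pos[OF s] by auto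
            \<comment> \<open>Since B vanishes at (s, t), the modulus bounds are exactly the hit
              conditions at the dyadic corner.\<close>
            have "j \<in> I" unfolding I_def hits_def
              using j1 j2 ma[OF st] mb[OF st] t(3) by (simp add: dyfloor_def i_def j_def)
            moreover have "p \<in> U j" unfolding U_def t(1)
              using dyfloor_bounds[OF t0, of n] by (auto simp: dyfloor_def j_def add_divide_distrib)
            ultimately show "p \<in> (\<Union>j\<in>I. U j)" by blast
          qed
          moreover have "(1/2) ^ n \<le> \<delta>" using n by simp
          moreover have "bounded (U j) \<and> diameter (U j) \<le> (1/2) ^ n" for j
          proof
            show "bounded (U j)" unfolding U_def by (intro bounded_Times) auto
            show "diameter (U j) \<le> (1/2) ^ n"
            proof (rule diameter_le)
              fix x y assume "x \<in> U j" "y \<in> U j"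
              then show "norm (x - y) \<le> (1/2) ^ n"
                by (auto simp: U_def norm_Pair add_divide_distrib power_divide abs_le_iff)
            qed simp
          qed
          moreover have "card I * ((1/2) ^ n) powr \<alpha> \<le> \<epsilon>"
          proof -
            have "card I * ((1/2) ^ n) powr \<alpha> \<le> (1 / \<beta> ^ 3) ^ n * (\<beta> ^ 4) ^ n"
              using mult_right_mono[OF less_imp_le[OF cardI], of "(\<beta> ^ 4) ^ n"] hpow[of n] \<beta>
              by (simp add: power_one_over)
            also have "\<dots> = (1 / \<beta> ^ 3 * \<beta> ^ 4) ^ n" by (rule power_mult_distrib[symmetric])
            also have "1 / \<beta> ^ 3 * \<beta> ^ 4 = \<beta>" using \<beta> by (simp add: power_def numeral_eq_Suc)
            finally show ?thesis using n by simp
          qed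
          ultimately show ?thesis by blast
        qed
      qed
    qed
  qed
qed

section \<open>From windows and fixed exponents to the dimension of whole slices\<close>

theorem theorem1p2:
  fixes M :: "'w measure" and B :: "'w \<Rightarrow> real \<times> real \<Rightarrow> real ^ 'd"
  assumes "CARD('d) = 2 \<or> CARD('d) = 3"
    and "brownian_sheet M B"
  shows "\<exists>N \<in> null_sets M. \<forall>w \<in> space M - N. \<forall>s > 0.
           hausdorff_dim ({p. fst p \<ge> 0 \<and> snd p \<ge> 0 \<and> B w p = 0} \<inter> ({s} \<times> {0<..})) = 0"
proof -
  interpret sheet M B by unfold_locales (rule assms(2))
  have "\<not> card (UNIV :: 'd set) \<le> Suc 0" using assms(1) by auto
  then obtain a b :: 'd where ab: "a \<noteq> b" using card_le_Suc0_iff_eq[of "UNIV :: 'd set"] by auto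
  define Z where "Z w s = {p. fst p \<ge> 0 \<and> snd p \<ge> 0 \<and> B w p = 0} \<inter> ({s} \<times> {0<..})" for w s
  let ?S = "\<lambda>K. {1 / 2 ^ K..<2 ^ K :: real}"
  \<comment> \<open>Only the exponents 1/(l+1) and the windows are combined, a countable family;
    \<open>s\<close> is already quantified inside each event.\<close>
  have "AE w in M. \<forall>l K. \<forall>s. hausdorff_measure (1 / real (Suc l))
      ({p. B w p = 0} \<inter> ({s} \<times> UNIV) \<inter> (?S K \<times> ?S K)) = 0"
    unfolding AE_all_countable by (intro allI zeros_hausdorff_null_AE[OF ab]) auto
  then have "AE w in M. \<forall>s>0. hausdorff_dim (Z w s) = 0"
  proof eventually_elim
    case (elim w)
    show ?case
    proof (intro allI impI)
      fix s :: real assume s: "s > 0"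
      have range: "\<forall>\<^sub>F K in sequentially. x \<in> ?S K" if "x > 0" for x
      proof -
        have "(\<lambda>K. 1 / 2 ^ K :: real) \<longlonglongrightarrow> 0" by real_asymp
        then have "\<forall>\<^sub>F K in sequentially. 1 / 2 ^ K < x" using that by (simp add: order_tendstoD)
        moreover have "filterlim (\<lambda>K. 2 ^ K :: real) at_top sequentially" by real_asymp
        then have "\<forall>\<^sub>F K in sequentially. x < 2 ^ K" by (simp add: filterlim_at_top_dense)
        ultimately show ?thesis by eventually_elim simp
      qed
      have "Z w s = (\<Union>K. {p. B w p = 0} \<inter> ({s} \<times> UNIV) \<inter> (?S K \<times> ?S K))"
      proof (intro equalityI subsetI)
        fix p assume p: "p \<in> Z w s"
        then obtain t where t: "p = (s, t)" "t > 0" "B w (s, t) = 0" by (auto simp: Z_def)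
        from eventually_happens[OF eventually_conj[OF range[OF s] range[OF t(2)]]]
        obtain K where "s \<in> ?S K" "t \<in> ?S K" by auto
        then show "p \<in> (\<Union>K. {p. B w p = 0} \<inter> ({s} \<times> UNIV) \<inter> (?S K \<times> ?S K))" using t by blast
      next
        fix p assume "p \<in> (\<Union>K. {p. B w p = 0} \<inter> ({s} \<times> UNIV) \<inter> (?S K \<times> ?S K))"
        then obtain K t where t: "p = (s, t)" "t \<in> ?S K" "B w (s, t) = 0" by auto
        have "0 < (1 / 2 ^ K :: real)" by simp
        then have "t > 0" using t(2) unfolding atLeastLessThan_iff by linarith
        then show "p \<in> Z w s" using t s by (simp add: Z_def)
      qed
      then have null: "hausdorff_measure (1 / real (Suc l)) (Z w s) = 0" for l
        using hausdorff_measure_UN_eq_0[of "1 / real (Suc l)" "\<lambda>K. {p. B w p = 0} \<inter> ({s} \<times> UNIV) \<inter> (?S K \<times> ?S K)"] elim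
        by simp
      show "hausdorff_dim (Z w s) = 0"
      proof (rule hausdorff_dim_eq_0I)
        fix e :: real assume "e > 0"
        then obtain l where "1 / real (Suc l) < e" using nat_approx_posE by blast
        then show "\<exists>\<alpha>. 0 \<le> \<alpha> \<and> \<alpha> < e \<and> hausdorff_measure \<alpha> (Z w s) = 0"
          using null[of l] by (intro exI[of _ "1 / real (Suc l)"]) auto
      qed
    qed
  qed
  \<comment> \<open>The exceptional set is only placed inside a measurable null set
    \<open>N\<close>; its own measurability is not claimed.\<close>
  then obtain N where "N \<in> null_sets M" "{w \<in> space M. \<not> (\<forall>s>0. hausdorff_dim (Z w s) = 0)} \<subseteq> N"
    unfolding eventually_ae_filter by blast
  then show ?thesis unfolding Z_def by blast
qed

end
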